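(* If a connected complex manifold $M$ has a bounded continuous strictly plurisubharmonic function, then $M$ is locally uniformly pluri-Greenian.
   Context: Plurisubharmonic functions take values in $[-\infty,\infty)$, and the function identically $-\infty$ is regarded as plurisubharmonic. A function $u$ on $M$ has a logarithmic pole at $w\in M$ if $u(z)-\log\|z-w\|$ is bounded above on some coordinate neighborhood of $w$ (the norm being the Euclidean norm in the local coordinates). The pluricomplex Green function of $M$ is $g_M(z,w)=\sup u(z)$ for $z,w\in M$, where the supremum is taken over all negative plurisubharmonic functions $u$ on $M$ with a logarithmic pole at $w$. The manifold $M$ is called locally uniformly pluri-Greenian if every point $w_0\in M$ has a coordinate neighborhood $U$ with the following property: there are an open set $W\subset U$ containing $w_0$ and a constant $c$ such that $g_M(z,w)\ge\log\|z-w\|+c$ for all $z\in U$ whenever $w\in W$. A plurisubharmonic function $u$ on $M$ is called strictly plurisubharmonic if for every point $w\in M$ there are a coordinate neighborhood $U$ containing $w$ and a number $\varepsilon>0$ such that the function $u(z)-\varepsilon\|z-w\|^2$ is plurisubharmonic on $U$. *)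

theory Defs
  imports "HOL-Analysis.Analysis"
begin

section \<open>Complex manifolds\<close>

text \<open>Holomorphic maps between complex coordinate spaces: real Frechet differentiable, with a
  complex linear derivative.\<close>

definition holomorphic_map_on :: "(complex^'n \<Rightarrow> complex^'m) \<Rightarrow> (complex^'n) set \<Rightarrow> bool" where
  "holomorphic_map_on f S \<longleftrightarrow>
     (\<forall>x\<in>S. \<exists>D. (f has_derivative D) (at x) \<and> (\<forall>c v. D (c *s v) = c *s D v))"

text \<open>A chart is a pair of an open set and a map that is only relevant on that set.\<close>

type_synonym ('a, 'n) chart = "'a set \<times> ('a \<Rightarrow> complex^'n)"

definition topological_chart :: "'a topology \<Rightarrow> ('a, 'n::finite) chart \<Rightarrow> bool" where
  "topological_chart X = (\<lambda>(U, \<phi>). openin X U \<and> open (\<phi> ` U) \<and>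
     homeomorphic_map (subtopology X U) (top_of_set (\<phi> ` U)) \<phi>)"

definition compatible_charts :: "('a, 'n::finite) chart \<Rightarrow> ('a, 'n) chart \<Rightarrow> bool" where
  "compatible_charts = (\<lambda>(U, \<phi>) (V, \<psi>).
     holomorphic_map_on (\<psi> \<circ> inv_into U \<phi>) (\<phi> ` (U \<inter> V)) \<and>
     holomorphic_map_on (\<phi> \<circ> inv_into V \<psi>) (\<psi> ` (U \<inter> V)))"

text \<open>The type variable \<open>'n\<close> carries the complex dimension, which is therefore positive.
  The atlas \<open>A\<close> need not be maximal.\<close>

definition complex_manifold :: "'a topology \<Rightarrow> ('a, 'n::finite) chart set \<Rightarrow> bool" where
  "complex_manifold X A \<longleftrightarrow>
     Hausdorff_space X \<and> second_countable X \<and>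
     (\<forall>c\<in>A. topological_chart X c) \<and>
     (\<forall>c\<in>A. \<forall>d\<in>A. compatible_charts c d) \<and>
     (\<Union>c\<in>A. fst c) = topspace X"

text \<open>The members of the maximal atlas. Their domains, with these coordinates, are the coordinate
  neighborhoods of the manifold.\<close>

definition holomorphic_charts :: "'a topology \<Rightarrow> ('a, 'n::finite) chart set \<Rightarrow> ('a, 'n) chart set" where
  "holomorphic_charts X A = {c. topological_chart X c \<and> (\<forall>d\<in>A. compatible_charts c d)}"


section \<open>Plurisubharmonic functions\<close>

text \<open>The integral of an extended-real function as the difference of the integrals of its positive
  and negative parts (\<^const>\<open>e2ennreal\<close> sends negative arguments to 0). It is meaningful
  only if one of the two is finite; for an upper semicontinuous function with values in
  \<open>[-\<infinity>,\<infinity>)\<close> on a circle, the first one is.\<close>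

definition ereal_integral :: "'a measure \<Rightarrow> ('a \<Rightarrow> ereal) \<Rightarrow> ereal" where
  "ereal_integral M f =
     enn2ereal (\<integral>\<^sup>+ x. e2ennreal (f x) \<partial>M) - enn2ereal (\<integral>\<^sup>+ x. e2ennreal (- f x) \<partial>M)"

definition circle_mean :: "(complex^'n \<Rightarrow> ereal) \<Rightarrow> complex^'n \<Rightarrow> complex^'n \<Rightarrow> ereal" where
  "circle_mean u a b = ereal_integral (uniform_measure lborel {0..2*pi}) (\<lambda>t. u (a + cis t *s b))"

text \<open>Upper semicontinuity, and the sub-mean value inequality on every closed disc of a complex
  line that is contained in \<open>S\<close>.\<close>

definition plurisubharmonic_on :: "(complex^'n::finite) set \<Rightarrow> (complex^'n \<Rightarrow> ereal) \<Rightarrow> bool" where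
  "plurisubharmonic_on S u \<longleftrightarrow>
     (\<forall>x\<in>S. u x < \<infinity>) \<and>
     (\<forall>r. openin (top_of_set S) {x\<in>S. u x < r}) \<and>
     (\<forall>a b. (\<forall>\<zeta>::complex. norm \<zeta> \<le> 1 \<longrightarrow> a + \<zeta> *s b \<in> S) \<longrightarrow> u a \<le> circle_mean u a b)"

definition psh_on ::
    "'a topology \<Rightarrow> ('a, 'n::finite) chart set \<Rightarrow> 'a set \<Rightarrow> ('a \<Rightarrow> ereal) \<Rightarrow> bool" where
  "psh_on X A G u \<longleftrightarrow> openin X G \<and>
     (\<forall>(U, \<phi>)\<in>holomorphic_charts X A. plurisubharmonic_on (\<phi> ` (U \<inter> G)) (u \<circ> inv_into U \<phi>))"

abbreviation psh :: "'a topology \<Rightarrow> ('a, 'n::finite) chart set \<Rightarrow> ('a \<Rightarrow> ereal) \<Rightarrow> bool" where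
  "psh X A u \<equiv> psh_on X A (topspace X) u"

definition strictly_psh :: "'a topology \<Rightarrow> ('a, 'n::finite) chart set \<Rightarrow> ('a \<Rightarrow> ereal) \<Rightarrow> bool" where
  "strictly_psh X A u \<longleftrightarrow> psh X A u \<and>
     (\<forall>w\<in>topspace X. \<exists>(U, \<phi>)\<in>holomorphic_charts X A. w \<in> U \<and>
        (\<exists>\<epsilon>::real. \<epsilon> > 0 \<and> psh_on X A U (\<lambda>z. u z - ereal (\<epsilon> * (norm (\<phi> z - \<phi> w))\<^sup>2))))"


section \<open>The pluricomplex Green function\<close>

text \<open>The logarithm with value \<open>-\<infinity>\<close> at 0 (whereas \<open>ln 0 = 0\<close> in the library).\<close>

definition elog :: "real \<Rightarrow> ereal" where
  "elog r = (if r \<le> 0 then -\<infinity> else ereal (ln r))"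

text \<open>The bound is written without the difference \<open>u z - elog (norm (\<phi> z - \<phi> w))\<close>, which at
  \<open>z = w\<close> could be the undefined \<open>-\<infinity> - (-\<infinity>)\<close>.\<close>

definition logarithmic_pole ::
    "'a topology \<Rightarrow> ('a, 'n::finite) chart set \<Rightarrow> ('a \<Rightarrow> ereal) \<Rightarrow> 'a \<Rightarrow> bool" where
  "logarithmic_pole X A u w \<longleftrightarrow>
     (\<exists>(U, \<phi>)\<in>holomorphic_charts X A. w \<in> U \<and>
        (\<exists>C::real. \<forall>z\<in>U. u z \<le> elog (norm (\<phi> z - \<phi> w)) + ereal C))"

definition green_function ::
    "'a topology \<Rightarrow> ('a, 'n::finite) chart set \<Rightarrow> 'a \<Rightarrow> 'a \<Rightarrow> ereal" where
  "green_function X A z w =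
     (SUP u \<in> {u. psh X A u \<and> (\<forall>x\<in>topspace X. u x < 0) \<and> logarithmic_pole X A u w}. u z)"

definition locally_uniformly_pluri_greenian ::
    "'a topology \<Rightarrow> ('a, 'n::finite) chart set \<Rightarrow> bool" where
  "locally_uniformly_pluri_greenian X A \<longleftrightarrow>
     (\<forall>w\<^sub>0\<in>topspace X. \<exists>(U, \<phi>)\<in>holomorphic_charts X A. w\<^sub>0 \<in> U \<and>
        (\<exists>W (c::real). openin X W \<and> W \<subseteq> U \<and> w\<^sub>0 \<in> W \<and>
           (\<forall>w\<in>W. \<forall>z\<in>U. green_function X A z w \<ge> elog (norm (\<phi> z - \<phi> w)) + ereal c)))"

end

theory Submission
  imports Defs "HOL-Complex_Analysis.Complex_Analysis"
begin

text \<open>Let \<open>\<phi>\<close> be coordinates around \<open>w0\<close> in which \<open>u - \<epsilon> \<parallel>\<phi> - \<phi> w0\<parallel>\<^sup>2\<close> is plurisubharmonic, and put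
  \<open>\<tau> = \<parallel>\<phi> - \<phi> w0\<parallel> / \<rho>\<close> and \<open>a = 1 / (\<epsilon> \<rho>\<^sup>2)\<close> for a small radius \<open>\<rho>\<close>. For \<open>w\<close> close to \<open>w0\<close>, the function
  \<open>F = log (\<parallel>\<phi> - \<phi> w\<parallel> / \<rho>) - \<tau>\<^sup>2 + a u + 2\<close> is plurisubharmonic, exceeds \<open>a u\<close> where \<open>3/4 < \<tau> \<le> 1\<close>
  and lies below \<open>a u\<close> where \<open>\<tau> \<ge> 7/4\<close>. Hence \<open>F\<close> for \<open>\<tau> < 1\<close>, \<open>max F (a u)\<close> for \<open>1 \<le> \<tau> < 2\<close> and
  \<open>a u\<close> elsewhere glue to a plurisubharmonic function with a logarithmic pole at \<open>w\<close>, which becomes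
  a competitor for the Green function after subtracting a constant independent of \<open>w\<close>. To stay with
  continuous real functions, the logarithm is truncated, and the glued function is the decreasing
  limit of its truncations. Gluing needs the fact that the sub-mean value inequality on small discs
  implies the one on all discs.\<close>

section \<open>Means over circles\<close>

text \<open>A mean that stays within real integrals. For continuous functions it agrees with
  \<open>circle_mean\<close> (see \<open>circle_mean_continuous\<close>), so extended-real integrals
  are needed only to translate from and to \<open>plurisubharmonic_on\<close>.\<close>

definition avg :: "(real \<Rightarrow> real) \<Rightarrow> real" where
  "avg f = integral {0..2*pi} f / (2*pi)"

lemma avg_const [simp]: "avg (\<lambda>t. c) = c"
  by (simp add: avg_def)

lemma avg_add:
  assumes "continuous_on {0..2*pi} f" "continuous_on {0..2*pi} g"
  shows "avg (\<lambda>t. f t + g t) = avg f + avg g"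
  unfolding avg_def
  by (simp add: integral_add integrable_continuous_real assms add_divide_distrib)

lemma avg_mult_left: "avg (\<lambda>t. c * f t) = c * avg f"
  by (simp add: avg_def)

lemma avg_mono:
  assumes "continuous_on {0..2*pi} f" "continuous_on {0..2*pi} g"
    and "\<And>t. t \<in> {0..2*pi} \<Longrightarrow> f t \<le> g t"
  shows "avg f \<le> avg g"
  unfolding avg_def
  by (intro divide_right_mono integral_le integrable_continuous_real assms) auto

text \<open>Equality case of the mean inequality: \<open>M - f\<close> is continuous and nonnegative
  with vanishing integral, hence zero on the whole interval.\<close>

lemma avg_eq_upper_bound:
  assumes "continuous_on {0..2*pi} f" "\<And>t. t \<in> {0..2*pi} \<Longrightarrow> f t \<le> M" "M \<le> avg f"
    and "t \<in> {0..2*pi}"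
  shows "f t = M"
proof -
  have int: "f integrable_on {0..2*pi}"
    using assms(1) by (rule integrable_continuous_real)
  have "M * (2*pi) \<le> integral {0..2*pi} f"
    using assms(3) by (simp add: avg_def field_simps)
  moreover have "integral {0..2*pi} (\<lambda>t. M - f t) = M * (2*pi) - integral {0..2*pi} f"
    using int by (simp add: integral_diff integrable_const_ivl)
  moreover have "integral {0..2*pi} (\<lambda>t. M - f t) \<ge> 0"
    using assms(2) int by (intro integral_nonneg integrable_diff integrable_const_ivl) auto
  ultimately have "integral {0..2*pi} (\<lambda>t. M - f t) = 0"
    by linarith
  moreover have "continuous_on {0..2*pi} (\<lambda>t. M - f t)"
    by (intro continuous_intros assms(1))
  ultimately have "\<forall>t\<in>{0..2*pi}. M - f t = 0"
    using assms(2) by (subst (asm) integral_eq_0_iff) auto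
  with assms(4) show ?thesis by auto
qed

text \<open>In polar form, replacing \<open>r\<close> by \<open>z\<close> shifts a
  \<open>2*pi\<close>-periodic integrand by the argument of \<open>z\<close>. Hence averages over
  rotations are radial.\<close>

lemma avg_rotate:
  fixes v :: "complex \<Rightarrow> real"
  assumes cont: "continuous_on (sphere 0 r) v" and z: "cmod z = r"
  shows "avg (\<lambda>t. v (cis t * z)) = avg (\<lambda>t. v (cis t * of_real r))"
proof -
  define f where "f t = v (cis t * of_real r)" for t
  have r: "r \<ge> 0" using z by auto
  have contf: "continuous_on T f" for T
    unfolding f_def using r
    by (intro continuous_on_compose2[OF cont] continuous_intros) (auto simp: norm_mult)
  have int: "f integrable_on {a..b}" for a b
    by (rule integrable_continuous_real[OF contf])
  define \<alpha> where "\<alpha> = Arg2pi z"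
  have \<alpha>: "0 \<le> \<alpha>" "\<alpha> \<le> 2*pi"
    using Arg2pi_ge_0 Arg2pi_lt_2pi by (auto simp: \<alpha>_def less_imp_le)
  have zr: "z = of_real r * cis \<alpha>"
    using Arg2pi_eq[of z] z by (simp add: \<alpha>_def cis_conv_exp mult.commute)
  have "integral {0..2*pi} (\<lambda>t. v (cis t * z)) = integral {0..2*pi} (f \<circ> (+) \<alpha>)"
    by (simp add: f_def zr o_def cis_mult[symmetric] mult_ac)
  also have "\<dots> = integral {\<alpha>..2*pi+\<alpha>} f"
    using integral_shift_Icc_real[of 0 "2*pi" f \<alpha>] by simp
  \<comment> \<open>The piece beyond \<open>2*pi\<close> is cut off and moved back to the start by
    periodicity.\<close>
  also have "\<dots> = integral {\<alpha>..2*pi} f + integral {2*pi..2*pi+\<alpha>} f"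
    using \<alpha> by (intro Henstock_Kurzweil_Integration.integral_combine[symmetric] int) auto
  also have "integral {2*pi..2*pi+\<alpha>} f = integral {0..\<alpha>} (f \<circ> (+) (2*pi))"
    using integral_shift_Icc_real[of 0 \<alpha> f "2*pi"] by (simp add: add.commute)
  also have "f \<circ> (+) (2*pi) = f"
    by (auto simp: f_def fun_eq_iff cis_mult[symmetric])
  also have "integral {\<alpha>..2*pi} f + integral {0..\<alpha>} f = integral {0..2*pi} f"
    using \<alpha> Henstock_Kurzweil_Integration.integral_combine[of 0 \<alpha> "2*pi" f] int by simp
  finally show ?thesis
    by (simp add: avg_def f_def[abs_def])
qed

lemma avg_swap:
  fixes f :: "real \<Rightarrow> real \<Rightarrow> real"
  assumes "continuous_on ({0..2*pi} \<times> {0..2*pi}) (\<lambda>(s, t). f s t)"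
  shows "avg (\<lambda>s. avg (\<lambda>t. f s t)) = avg (\<lambda>t. avg (\<lambda>s. f s t))"
proof -
  have "integral (cbox 0 (2*pi)) (\<lambda>s. integral (cbox 0 (2*pi)) (f s)) =
        integral (cbox 0 (2*pi)) (\<lambda>t. integral (cbox 0 (2*pi)) (\<lambda>s. f s t))"
    using assms by (intro integral_swap_continuous) (simp add: cbox_Pair_eq)
  then show ?thesis by (simp add: avg_def)
qed

lemma continuous_on_avg:
  fixes f :: "'a::topological_space \<Rightarrow> real \<Rightarrow> real"
  assumes "continuous_on (U \<times> {0..2*pi}) (\<lambda>(x, t). f x t)"
  shows "continuous_on U (\<lambda>x. avg (f x))"
  unfolding avg_def
  using integral_continuous_on_param[of U 0 "2*pi" f] assms
  by (intro continuous_intros) auto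

text \<open>Averaging over rotations makes the function radial; at a point of largest modulus where the
  radial function attains its maximum, the local inequality would force the maximum to be attained
  even farther out.\<close>

lemma local_sub_mean_imp_sub_mean:
  fixes v :: "complex \<Rightarrow> real"
  assumes cont: "continuous_on (cball 0 1) v"
    and local: "\<And>\<zeta>. cmod \<zeta> < 1 \<Longrightarrow>
      \<exists>R>0. \<forall>\<xi> \<omega>. cball \<xi> (cmod \<omega>) \<subseteq> ball \<zeta> R \<longrightarrow> v \<xi> \<le> avg (\<lambda>t. v (\<xi> + cis t * \<omega>))"
  shows "v 0 \<le> avg (\<lambda>t. v (cis t))"
proof -
  define V where "V \<zeta> = avg (\<lambda>\<theta>. v (cis \<theta> * \<zeta>))" for \<zeta>
  have contV: "continuous_on (cball 0 1) V"
    unfolding V_def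
    by (intro continuous_on_avg, unfold split_beta, intro continuous_on_compose2[OF cont] continuous_intros)
       (auto simp: norm_mult)
  have V0: "V 0 = v 0" by (simp add: V_def)
  have V_radial: "V \<zeta> = V (of_real (cmod \<zeta>))" if "cmod \<zeta> \<le> 1" for \<zeta>
    unfolding V_def by (rule avg_rotate[OF continuous_on_subset[OF cont]]) (use that in auto)
  obtain m where m: "m \<in> cball 0 1" "\<And>x. x \<in> cball 0 1 \<Longrightarrow> V x \<le> V m"
    using continuous_attains_sup[OF compact_cball _ contV] by auto
  \<comment> \<open>The set where the radial average attains its maximum is compact, so it has a
    point \<open>z\<close> of largest modulus.\<close>
  define K where "K = cball 0 1 \<inter> V -` {V m}"
  have "closed K"
    unfolding K_def by (intro continuous_closed_preimage contV) auto
  then have "compact K"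
    by (auto simp: K_def compact_eq_bounded_closed)
  moreover have "K \<noteq> {}" using m by (auto simp: K_def)
  ultimately obtain z where z: "z \<in> K" "\<And>x. x \<in> K \<Longrightarrow> cmod x \<le> cmod z"
    using continuous_attains_sup[OF _ _ continuous_on_norm_id, of K] by blast
  have z1: "cmod z \<le> 1" and Vz: "V z = V m" using z(1) by (auto simp: K_def)
  show ?thesis
  proof (cases "cmod z = 1")
    case True
    \<comment> \<open>A maximum attained on the unit circle is attained at 1 as well, and
      \<open>V 1\<close> is the mean in the claim.\<close>
    have "v 0 \<le> V z" using m(2)[of 0] V0 Vz by simp
    also have "V z = V 1" using V_radial[OF z1] True by simp
    finally show ?thesis by (simp add: V_def)
  next
    case False
    with z1 have z1: "cmod z < 1" by simp
    \<comment> \<open>The radius supplied by \<open>local\<close> depends on the centre. A Lebesgue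
      number for this cover of the circle through \<open>z\<close> gives one radius for all rotated
      centres, as averaging over \<open>\<theta>\<close> requires.\<close>
    define \<G> where "\<G> = {G. open G \<and> (\<forall>\<xi> \<omega>. cball \<xi> (cmod \<omega>) \<subseteq> G \<longrightarrow> v \<xi> \<le> avg (\<lambda>t. v (\<xi> + cis t * \<omega>)))}"
    have "sphere 0 (cmod z) \<subseteq> \<Union>\<G>"
    proof
      fix \<zeta> :: complex assume "\<zeta> \<in> sphere 0 (cmod z)"
      then obtain R where "R > 0" "ball \<zeta> R \<in> \<G>"
        using local[of \<zeta>] z1 by (auto simp: \<G>_def)
      then show "\<zeta> \<in> \<Union>\<G>" by (meson UnionI centre_in_ball)
    qed
    then obtain e where e: "e > 0" "\<And>x. x \<in> sphere 0 (cmod z) \<Longrightarrow> \<exists>G\<in>\<G>. ball x e \<subseteq> G"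
      by (rule Heine_Borel_lemma[OF compact_sphere]) (auto simp: \<G>_def)
    define r where "r = min (e/2) (1 - cmod z)"
    have r: "r > 0" "r < e" "cmod z + r \<le> 1" using e(1) z1 by (auto simp: r_def min_def)
    have in_disc: "cmod (z + cis t * of_real r) \<le> 1" for t
      using norm_triangle_ineq[of z "cis t * of_real r"] r by (simp add: norm_mult)
    \<comment> \<open>The radius vector is rotated together with the centre, so that
      \<open>cis \<theta>\<close> becomes a common factor and averaging over \<open>\<theta>\<close>
      produces \<open>V\<close> on a circle around \<open>z\<close>.\<close>
    have sub: "v (cis \<theta> * z) \<le> avg (\<lambda>t. v (cis \<theta> * (z + cis t * of_real r)))" for \<theta>
    proof -
      obtain G where "G \<in> \<G>" "ball (cis \<theta> * z) e \<subseteq> G"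
        using e(2)[of "cis \<theta> * z"] by (auto simp: norm_mult)
      moreover have "cball (cis \<theta> * z) (cmod (cis \<theta> * of_real r)) \<subseteq> ball (cis \<theta> * z) e"
        using r by (auto simp: norm_mult)
      ultimately have "v (cis \<theta> * z) \<le> avg (\<lambda>t. v (cis \<theta> * z + cis t * (cis \<theta> * of_real r)))"
        unfolding \<G>_def by blast
      then show ?thesis by (simp add: algebra_simps)
    qed
    have cont2: "continuous_on (T::(real\<times>real) set) (\<lambda>(\<theta>, t). v (cis \<theta> * (z + cis t * of_real r)))" for T
      unfolding split_beta using in_disc
      by (intro continuous_on_compose2[OF cont] continuous_intros) (auto simp: norm_mult)
    have "V m = avg (\<lambda>\<theta>. v (cis \<theta> * z))" using Vz by (simp add: V_def)
    also have "\<dots> \<le> avg (\<lambda>\<theta>. avg (\<lambda>t. v (cis \<theta> * (z + cis t * of_real r))))"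
      by (intro avg_mono sub continuous_on_avg cont2 continuous_on_compose2[OF cont] continuous_intros)
         (use z1 in \<open>auto simp: norm_mult\<close>)
    also have "\<dots> = avg (\<lambda>t. V (z + cis t * of_real r))"
      unfolding V_def by (rule avg_swap[OF cont2])
    finally have le: "V m \<le> avg (\<lambda>t. V (z + cis t * of_real r))" .
    \<comment> \<open>This direction points away from 0: the equality case puts a point of modulus
      \<open>cmod z + r\<close> into \<open>K\<close>, against the choice of \<open>z\<close>. For
      \<open>z = 0\<close> every direction is outward, so the default value of \<open>Arg2pi\<close>
      serves too.\<close>
    define \<alpha> where "\<alpha> = Arg2pi z"
    have zr: "z = of_real (cmod z) * cis \<alpha>"
      using Arg2pi_eq[of z] by (simp add: \<alpha>_def cis_conv_exp mult.commute)
    have "V (z + cis \<alpha> * of_real r) = V m"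
    proof (rule avg_eq_upper_bound[OF _ _ le])
      show "continuous_on {0..2*pi} (\<lambda>t. V (z + cis t * of_real r))"
        by (intro continuous_on_compose2[OF contV] continuous_intros) (use in_disc in auto)
      show "\<alpha> \<in> {0..2*pi}"
        using Arg2pi_ge_0 Arg2pi_lt_2pi by (auto simp: \<alpha>_def less_imp_le)
    qed (use m(2) in_disc in auto)
    then have "z + cis \<alpha> * of_real r \<in> K" using in_disc by (auto simp: K_def)
    from z(2)[OF this] have "cmod (z + cis \<alpha> * of_real r) \<le> cmod z" .
    moreover have "z + cis \<alpha> * of_real r = of_real (cmod z + r) * cis \<alpha>"
      by (subst (1) zr) (simp add: algebra_simps)
    then have "cmod (z + cis \<alpha> * of_real r) = \<bar>cmod z + r\<bar>"
      by (simp only: norm_mult norm_cis norm_of_real mult_1_right)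
    ultimately have False using r(1) by simp
    then show ?thesis ..
  qed
qed

text \<open>Mean value property of harmonic functions, read off from Cauchy's integral formula at
  the centre of the circle.\<close>

lemma avg_Re_holomorphic:
  assumes "h holomorphic_on S" "open S" "cball 0 1 \<subseteq> S"
  shows "avg (\<lambda>t. Re (h (cis t))) = Re (h 0)"
proof -
  have "((\<lambda>u. h u / (u - 0)) has_contour_integral 2 * of_real pi * \<i> * h 0) (circlepath 0 1)"
    by (rule Cauchy_integral_circlepath_simple) (use assms holomorphic_on_subset in auto)
  then have "((\<lambda>t. h (cis t) / cis t * \<i> * cis t) has_integral 2 * of_real pi * \<i> * h 0) {0..2*pi}"
    unfolding circlepath_def by (subst (asm) has_contour_integral_part_circlepath_iff) auto
  then have "((\<lambda>t. \<i> * h (cis t)) has_integral 2 * of_real pi * \<i> * h 0) {0..2*pi}"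
    by (simp add: mult.commute)
  \<comment> \<open>The factor \<open>\<i>\<close> left over from the parametrization makes the
    imaginary part of the integrand equal to the real part of \<open>h\<close>.\<close>
  from has_integral_linear[OF this bounded_linear_Im]
  have "((\<lambda>t. Re (h (cis t))) has_integral 2 * pi * Re (h 0)) {0..2*pi}"
    by (simp add: o_def)
  then show ?thesis
    by (simp add: avg_def integral_unique)
qed

section \<open>Continuous plurisubharmonic functions\<close>

text \<open>The continuous real-valued case of \<open>plurisubharmonic_on\<close>. Sums, maxima and
  gluing are handled in this class without measurability questions; decreasing limits lead back to
  the general notion.\<close>

definition cpsh_on :: "(complex^'n::finite) set \<Rightarrow> (complex^'n \<Rightarrow> real) \<Rightarrow> bool" where
  "cpsh_on S p \<longleftrightarrow> continuous_on S p \<and>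
     (\<forall>a b. (\<forall>\<zeta>. cmod \<zeta> \<le> 1 \<longrightarrow> a + \<zeta> *s b \<in> S) \<longrightarrow> p a \<le> avg (\<lambda>t. p (a + cis t *s b)))"

lemma continuous_on_line [continuous_intros]:
  fixes f :: "'a::topological_space \<Rightarrow> complex" and a b :: "complex^'n"
  assumes "continuous_on T f"
  shows "continuous_on T (\<lambda>x. a + f x *s b)"
  unfolding vector_scalar_mult_def by (intro continuous_intros assms)

lemma continuous_on_circle:
  assumes "continuous_on S p" "\<And>\<zeta>. cmod \<zeta> \<le> 1 \<Longrightarrow> a + \<zeta> *s b \<in> S"
  shows "continuous_on T (\<lambda>t. p (a + cis t *s b))"
  by (intro continuous_on_compose2[OF assms(1)] continuous_intros) (use assms(2) in auto)

lemma cpsh_onI: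
  assumes "continuous_on S p"
    and "\<And>a b. (\<And>\<zeta>. cmod \<zeta> \<le> 1 \<Longrightarrow> a + \<zeta> *s b \<in> S) \<Longrightarrow> p a \<le> avg (\<lambda>t. p (a + cis t *s b))"
  shows "cpsh_on S p"
  using assms by (simp add: cpsh_on_def)

lemma cpsh_on_imp_continuous: "cpsh_on S p \<Longrightarrow> continuous_on S p"
  by (simp add: cpsh_on_def)

lemma cpsh_onD:
  assumes "cpsh_on S p" "\<And>\<zeta>. cmod \<zeta> \<le> 1 \<Longrightarrow> a + \<zeta> *s b \<in> S"
  shows "p a \<le> avg (\<lambda>t. p (a + cis t *s b))"
  using assms by (simp add: cpsh_on_def)

section \<open>Closure properties and locality of the sub-mean value inequality\<close>

lemma cpsh_on_subset: "cpsh_on S p \<Longrightarrow> T \<subseteq> S \<Longrightarrow> cpsh_on T p"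
  unfolding cpsh_on_def by (meson continuous_on_subset subsetD)

lemma cpsh_on_cong:
  assumes "cpsh_on S p" "\<And>x. x \<in> S \<Longrightarrow> p x = q x"
  shows "cpsh_on S q"
proof (rule cpsh_onI)
  show "continuous_on S q"
    using assms by (auto simp: cpsh_on_def cong: continuous_on_cong)
  fix a b :: "complex^'a"
  assume *: "\<And>\<zeta>. cmod \<zeta> \<le> 1 \<Longrightarrow> a + \<zeta> *s b \<in> S"
  have "a \<in> S" using *[of 0] by simp
  then show "q a \<le> avg (\<lambda>t. q (a + cis t *s b))"
    using cpsh_onD[OF assms(1) *] assms(2) * by simp
qed

lemma cpsh_on_const [simp]: "cpsh_on S (\<lambda>x. c)"
  by (rule cpsh_onI) auto

lemma cpsh_on_add:
  assumes "cpsh_on S p" "cpsh_on S q"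
  shows "cpsh_on S (\<lambda>x. p x + q x)"
proof (rule cpsh_onI)
  show "continuous_on S (\<lambda>x. p x + q x)"
    by (intro continuous_intros cpsh_on_imp_continuous assms)
  fix a b :: "complex^'a"
  assume *: "\<And>\<zeta>. cmod \<zeta> \<le> 1 \<Longrightarrow> a + \<zeta> *s b \<in> S"
  then show "p a + q a \<le> avg (\<lambda>t. p (a + cis t *s b) + q (a + cis t *s b))"
    using cpsh_onD[OF assms(1) *] cpsh_onD[OF assms(2) *]
    by (subst avg_add) (auto intro!: continuous_on_circle[of S] cpsh_on_imp_continuous assms)
qed

lemma cpsh_on_scale:
  assumes "cpsh_on S p" "c \<ge> 0"
  shows "cpsh_on S (\<lambda>x. c * p x)"
proof (rule cpsh_onI)
  show "continuous_on S (\<lambda>x. c * p x)"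
    by (intro continuous_intros cpsh_on_imp_continuous assms)
  fix a b :: "complex^'a"
  assume *: "\<And>\<zeta>. cmod \<zeta> \<le> 1 \<Longrightarrow> a + \<zeta> *s b \<in> S"
  then show "c * p a \<le> avg (\<lambda>t. c * p (a + cis t *s b))"
    using cpsh_onD[OF assms(1) *] assms(2) by (simp add: avg_mult_left mult_left_mono)
qed

lemma cpsh_on_max:
  assumes "cpsh_on S p" "cpsh_on S q"
  shows "cpsh_on S (\<lambda>x. max (p x) (q x))"
proof (rule cpsh_onI)
  show cont: "continuous_on S (\<lambda>x. max (p x) (q x))"
    by (intro continuous_intros cpsh_on_imp_continuous assms)
  fix a b :: "complex^'a"
  assume *: "\<And>\<zeta>. cmod \<zeta> \<le> 1 \<Longrightarrow> a + \<zeta> *s b \<in> S"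
  have "p a \<le> avg (\<lambda>t. max (p (a + cis t *s b)) (q (a + cis t *s b)))"
    by (rule order.trans[OF cpsh_onD[OF assms(1) *] avg_mono])
       (use * in \<open>auto intro!: continuous_on_circle[of S] continuous_on_max cpsh_on_imp_continuous assms\<close>)
  moreover have "q a \<le> avg (\<lambda>t. max (p (a + cis t *s b)) (q (a + cis t *s b)))"
    by (rule order.trans[OF cpsh_onD[OF assms(2) *] avg_mono])
       (use * in \<open>auto intro!: continuous_on_circle[of S] continuous_on_max cpsh_on_imp_continuous assms\<close>)
  ultimately show "max (p a) (q a) \<le> avg (\<lambda>t. max (p (a + cis t *s b)) (q (a + cis t *s b)))"
    by simp
qed

text \<open>Along a complex line, a disc in \<open>S\<close> becomes the closed unit disc of the
  plane, where \<open>local_sub_mean_imp_sub_mean\<close> applies. All gluing rests on this.\<close>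

lemma cpsh_on_local:
  assumes "\<And>x. x \<in> S \<Longrightarrow> \<exists>T. open T \<and> x \<in> T \<and> cpsh_on T p"
  shows "cpsh_on S p"
proof (rule cpsh_onI)
  show cont: "continuous_on S p"
    using assms cpsh_on_imp_continuous
    by (meson continuous_at_imp_continuous_on continuous_on_eq_continuous_at)
  fix a b :: "complex^'a"
  assume *: "\<And>\<zeta>. cmod \<zeta> \<le> 1 \<Longrightarrow> a + \<zeta> *s b \<in> S"
  have "p (a + 0 *s b) \<le> avg (\<lambda>t. p (a + cis t *s b))"
  proof (rule local_sub_mean_imp_sub_mean[of "\<lambda>\<zeta>. p (a + \<zeta> *s b)"])
    show "continuous_on (cball 0 1) (\<lambda>\<zeta>. p (a + \<zeta> *s b))"
      by (intro continuous_on_compose2[OF cont] continuous_intros) (use * in auto)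
    fix \<zeta> :: complex assume "cmod \<zeta> < 1"
    then obtain T where T: "open T" "a + \<zeta> *s b \<in> T" "cpsh_on T p"
      using assms * by (meson less_imp_le)
    have "open ((\<lambda>\<zeta>. a + \<zeta> *s b) -` T)"
      by (intro open_vimage T continuous_intros)
    then obtain R where R: "R > 0" "ball \<zeta> R \<subseteq> (\<lambda>\<zeta>. a + \<zeta> *s b) -` T"
      using T(2) open_contains_ball by (metis vimageI)
    have "p (a + \<xi> *s b) \<le> avg (\<lambda>t. p (a + (\<xi> + cis t * \<omega>) *s b))"
      if sub: "cball \<xi> (cmod \<omega>) \<subseteq> ball \<zeta> R" for \<xi> \<omega>
    proof -
      \<comment> \<open>A small disc in the parameter plane is again a disc of a complex line, with
        direction \<open>\<omega> *s b\<close>, so the inequality known on \<open>T\<close> applies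
        to it.\<close>
      have eq: "a + (\<xi> + \<eta> * \<omega>) *s b = (a + \<xi> *s b) + \<eta> *s (\<omega> *s b)" for \<eta>
        by (simp add: vector_sadd_rdistrib vector_smult_assoc algebra_simps)
      have "(a + \<xi> *s b) + \<eta> *s (\<omega> *s b) \<in> T" if "cmod \<eta> \<le> 1" for \<eta>
      proof -
        have "\<xi> + \<eta> * \<omega> \<in> cball \<xi> (cmod \<omega>)"
          using that by (simp add: dist_norm norm_mult mult_left_le_one_le)
        then have "a + (\<xi> + \<eta> * \<omega>) *s b \<in> T" using sub R(2) by blast
        then show ?thesis unfolding eq .
      qed
      from cpsh_onD[OF T(3) this] show ?thesis unfolding eq .
    qed
    with R(1) show "\<exists>R>0. \<forall>\<xi> \<omega>. cball \<xi> (cmod \<omega>) \<subseteq> ball \<zeta> R \<longrightarrow>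
        p (a + \<xi> *s b) \<le> avg (\<lambda>t. p (a + (\<xi> + cis t * \<omega>) *s b))"
      by blast
  qed
  then show "p a \<le> avg (\<lambda>t. p (a + cis t *s b))" by simp
qed

section \<open>Holomorphic maps and the logarithm of their norm\<close>

lemma holomorphic_map_on_imp_continuous_on:
  "holomorphic_map_on f S \<Longrightarrow> continuous_on S f"
  unfolding holomorphic_map_on_def
  by (meson continuous_at_imp_continuous_on has_derivative_continuous)

lemma holomorphic_map_on_line:
  fixes f :: "complex^'n::finite \<Rightarrow> complex^'m::finite"
  assumes "holomorphic_map_on f S"
  shows "(\<lambda>\<zeta>. f (a + \<zeta> *s b) $ i) holomorphic_on {\<zeta>. a + \<zeta> *s b \<in> S}"
proof (rule holomorphic_onI)
  fix \<zeta> assume "\<zeta> \<in> {\<zeta>. a + \<zeta> *s b \<in> S}"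
  then obtain D where D: "(f has_derivative D) (at (a + \<zeta> *s b))" "\<And>c v. D (c *s v) = c *s D v"
    using assms by (auto simp: holomorphic_map_on_def)
  have lin: "bounded_linear (\<lambda>\<zeta>::complex. \<zeta> *s b)"
    unfolding linear_conv_bounded_linear[symmetric]
    by (intro linearI) (auto simp: vec_eq_iff algebra_simps)
  have "((\<lambda>\<zeta>. a + \<zeta> *s b) has_derivative (\<lambda>\<zeta>. \<zeta> *s b)) (at \<zeta>)"
    using has_derivative_add[OF has_derivative_const bounded_linear_imp_has_derivative[OF lin]]
    by simp
  from has_derivative_compose[OF this D(1)]
  have "((\<lambda>\<zeta>. f (a + \<zeta> *s b)) has_derivative (\<lambda>\<zeta>. D (\<zeta> *s b))) (at \<zeta>)" .
  from bounded_linear.has_derivative[OF bounded_linear_vec_nth this]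
  have "((\<lambda>\<zeta>. f (a + \<zeta> *s b) $ i) has_derivative (\<lambda>\<zeta>. D (\<zeta> *s b) $ i)) (at \<zeta>)" .
  \<comment> \<open>Complex linearity of \<open>D\<close> enters here: the real derivative along the
    line is multiplication by the complex number \<open>D b $ i\<close>.\<close>
  then have "((\<lambda>\<zeta>. f (a + \<zeta> *s b) $ i) has_field_derivative (D b $ i)) (at \<zeta>)"
    unfolding has_field_derivative_def D(2) by (simp add: mult.commute[of _ "D b $ i"])
  then show "(\<lambda>\<zeta>. f (a + \<zeta> *s b) $ i) field_differentiable at \<zeta> within {\<zeta>. a + \<zeta> *s b \<in> S}"
    using field_differentiable_at_within field_differentiable_def by blast
qed

text \<open>Cauchy-Schwarz for the Hermitian product, by reduction to the real inequality for the
  moduli of the coordinates.\<close>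

lemma norm_sum_cnj_mult_le:
  fixes x y :: "complex^'n::finite"
  shows "cmod (\<Sum>i\<in>UNIV. x $ i * cnj (y $ i)) \<le> norm x * norm y"
proof -
  have "cmod (\<Sum>i\<in>UNIV. x $ i * cnj (y $ i)) \<le> (\<Sum>i\<in>UNIV. cmod (x $ i) * cmod (y $ i))"
    by (rule order.trans[OF norm_sum]) (simp add: norm_mult)
  also have "\<dots> \<le> norm x * norm y"
    using L2_set_mult_ineq[of "\<lambda>i. cmod (x $ i)" "\<lambda>i. cmod (y $ i)" UNIV] by (simp add: norm_vec_def)
  finally show ?thesis .
qed

text \<open>At the centre of a disc, the logarithm of the norm agrees with that of the modulus of the
  Hermitian product with the value there, which is harmonic where this product has positive
  real part.\<close>

lemma cpsh_on_ln_norm: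
  fixes f :: "complex^'n::finite \<Rightarrow> complex^'m::finite"
  assumes hol: "holomorphic_map_on f S" and "open S"
    and pos: "\<And>x y. x \<in> S \<Longrightarrow> y \<in> S \<Longrightarrow> inner (f x) (f y) > 0"
  shows "cpsh_on S (\<lambda>x. ln (norm (f x)))"
proof (rule cpsh_onI)
  have nz: "f x \<noteq> 0" if "x \<in> S" for x using pos[OF that that] by auto
  show cont: "continuous_on S (\<lambda>x. ln (norm (f x)))"
    by (intro continuous_intros holomorphic_map_on_imp_continuous_on hol) (use nz in auto)
  fix a b :: "complex^'n"
  assume *: "\<And>\<zeta>. cmod \<zeta> \<le> 1 \<Longrightarrow> a + \<zeta> *s b \<in> S"
  have a: "a \<in> S" using *[of 0] by simp
  define L where "L = {\<zeta>. a + \<zeta> *s b \<in> S}"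
  have "open ((\<lambda>\<zeta>. a + \<zeta> *s b) -` S)"
    by (intro open_vimage \<open>open S\<close> continuous_intros)
  then have L: "open L" "cball 0 1 \<subseteq> L" using * by (auto simp: L_def vimage_def)
  \<comment> \<open>The real part of \<open>h\<close> is the real inner product of the values of
    \<open>f\<close>, so \<open>pos\<close> keeps \<open>h\<close> in the right half-plane, where
    \<open>Ln\<close> is holomorphic and \<open>ln (cmod (h \<zeta>))\<close> is the real part of
    \<open>Ln (h \<zeta>)\<close>.\<close>
  define h where "h \<zeta> = (\<Sum>i\<in>UNIV. f (a + \<zeta> *s b) $ i * cnj (f a $ i))" for \<zeta>
  have Reh: "Re (h \<zeta>) > 0" if "\<zeta> \<in> L" for \<zeta>
    using pos[of "a + \<zeta> *s b" a] that a by (simp add: h_def inner_vec_def inner_complex_def L_def)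
  have "h holomorphic_on L"
    unfolding h_def L_def
    by (intro holomorphic_on_sum holomorphic_on_mult holomorphic_on_const holomorphic_map_on_line hol)
  then have "(\<lambda>\<zeta>. Ln (h \<zeta>)) holomorphic_on L"
    by (intro holomorphic_on_Ln') (use Reh in \<open>force simp: complex_nonpos_Reals_iff\<close>)+
  from avg_Re_holomorphic[OF this L]
  have "avg (\<lambda>t. Re (Ln (h (cis t)))) = Re (Ln (h 0))" .
  moreover have "Re (Ln (h \<zeta>)) = ln (cmod (h \<zeta>))" if "\<zeta> \<in> L" for \<zeta>
    using Reh[OF that] by (intro Re_Ln) auto
  ultimately have avg: "avg (\<lambda>t. ln (cmod (h (cis t)))) = ln (cmod (h 0))"
    using L(2) by (simp add: subset_iff)
  have h0: "h 0 = of_real ((norm (f a))\<^sup>2)"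
    by (simp add: h_def norm_vec_def L2_set_def sum_nonneg complex_norm_square[symmetric])
  \<comment> \<open>At the centre, \<open>h\<close> is the squared norm of \<open>f a\<close>, hence
    the factor 2. One of the two copies cancels at the end against the factor
    \<open>norm (f a)\<close> from Cauchy-Schwarz.\<close>
  have "2 * ln (norm (f a)) = ln (cmod (h 0))"
    using nz[OF a] by (simp add: h0 norm_power ln_realpow)
  also have "\<dots> = avg (\<lambda>t. ln (cmod (h (cis t))))" by (simp add: avg)
  also have "\<dots> \<le> avg (\<lambda>t. ln (norm (f (a + cis t *s b))) + ln (norm (f a)))"
  proof (rule avg_mono)
    have "continuous_on L h"
      using \<open>h holomorphic_on L\<close> holomorphic_on_imp_continuous_on by blast
    then have "continuous_on L (\<lambda>\<zeta>. ln (cmod (h \<zeta>)))"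
      by (intro continuous_intros) (use Reh in force)+
    then show "continuous_on {0..2*pi} (\<lambda>t. ln (cmod (h (cis t))))"
      by (rule continuous_on_compose2) (use L(2) in \<open>auto intro: continuous_intros\<close>)
    show "continuous_on {0..2*pi} (\<lambda>t. ln (norm (f (a + cis t *s b))) + ln (norm (f a)))"
      by (intro continuous_on_add continuous_on_const continuous_on_circle[OF cont] *)
    fix t
    have "cis t \<in> L" using L(2) by auto
    then have "cmod (h (cis t)) > 0" "a + cis t *s b \<in> S" using Reh[of "cis t"] by (auto simp: L_def)
    moreover have "cmod (h (cis t)) \<le> norm (f (a + cis t *s b)) * norm (f a)"
      unfolding h_def by (rule norm_sum_cnj_mult_le)
    ultimately show "ln (cmod (h (cis t))) \<le> ln (norm (f (a + cis t *s b))) + ln (norm (f a))"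
      using nz[OF a] nz[of "a + cis t *s b"] by (subst ln_mult_pos[symmetric]) auto
  qed
  also have "\<dots> = avg (\<lambda>t. ln (norm (f (a + cis t *s b)))) + ln (norm (f a))"
    by (subst avg_add) (auto intro: continuous_on_circle[OF cont] *)
  finally show "ln (norm (f a)) \<le> avg (\<lambda>t. ln (norm (f (a + cis t *s b))))" by simp
qed

lemma holomorphic_map_on_subset:
  "holomorphic_map_on f S \<Longrightarrow> T \<subseteq> S \<Longrightarrow> holomorphic_map_on f T"
  by (auto simp: holomorphic_map_on_def)

text \<open>The property is local: near a zero of \<open>f\<close> the truncation makes the function
  constant, and near any other point it is the maximum of \<open>ln (norm (f x))\<close> and a
  constant.\<close>

lemma cpsh_on_ln_max_norm:
  fixes f :: "complex^'n::finite \<Rightarrow> complex^'m::finite"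
  assumes hol: "holomorphic_map_on f S" and "open S" and "\<delta> > 0"
  shows "cpsh_on S (\<lambda>x. ln (max (norm (f x)) \<delta>))"
proof (rule cpsh_on_local)
  have cont: "continuous_on S f" by (rule holomorphic_map_on_imp_continuous_on[OF hol])
  fix x assume x: "x \<in> S"
  show "\<exists>T. open T \<and> x \<in> T \<and> cpsh_on T (\<lambda>x. ln (max (norm (f x)) \<delta>))"
  proof (cases "f x = 0")
    case True
    define T where "T = S \<inter> f -` ball 0 \<delta>"
    have "cpsh_on T (\<lambda>x. ln (max (norm (f x)) \<delta>))"
      by (rule cpsh_on_cong[OF cpsh_on_const[of T "ln \<delta>"]]) (auto simp: T_def max_def)
    moreover have "open T"
      unfolding T_def by (rule continuous_open_preimage[OF cont \<open>open S\<close>]) auto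
    ultimately show ?thesis using x True \<open>\<delta> > 0\<close> by (auto simp: T_def)
  next
    case False
    \<comment> \<open>With a quarter of the norm, two values on \<open>T\<close> differ by less than
      \<open>2 * r\<close> while each has norm above \<open>3 * r\<close>, which makes their inner
      product positive.\<close>
    define r where "r = norm (f x) / 4"
    have r: "r > 0" using False by (simp add: r_def)
    define T where "T = S \<inter> f -` ball (f x) r"
    have T: "open T" "T \<subseteq> S" "x \<in> T"
      unfolding T_def using x r by (auto intro: continuous_open_preimage[OF cont \<open>open S\<close>])
    have pos: "inner (f y) (f z) > 0" if "y \<in> T" "z \<in> T" for y z
    proof -
      have yz: "norm (f y - f x) < r" "norm (f z - f x) < r"
        using that by (auto simp: T_def dist_norm norm_minus_commute)
      have "norm (f y - f z) < 2 * r"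
        using norm_triangle_ineq4[of "f y - f x" "f z - f x"] yz by simp
      moreover have "norm (f x) \<le> norm (f z) + norm (f z - f x)"
        by (metis norm_minus_commute norm_triangle_sub)
      then have "norm (f z) > 3 * r" using yz(2) by (simp add: r_def)
      ultimately have "norm (f y - f z) * norm (f z) < norm (f z) * norm (f z)"
        using r by (intro mult_strict_right_mono) auto
      moreover have "\<bar>inner (f y - f z) (f z)\<bar> \<le> norm (f y - f z) * norm (f z)"
        by (rule Cauchy_Schwarz_ineq2)
      moreover have "inner (f y) (f z) = inner (f y - f z) (f z) + norm (f z) * norm (f z)"
        by (simp add: inner_diff_left norm_eq_sqrt_inner)
      ultimately show ?thesis by linarith
    qed
    have "cpsh_on T (\<lambda>x. max (ln (norm (f x))) (ln \<delta>))"
      by (intro cpsh_on_max cpsh_on_const cpsh_on_ln_norm holomorphic_map_on_subset[OF hol] T pos)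
    moreover have "f y \<noteq> 0" if "y \<in> T" for y
      using pos[OF that that] by auto
    ultimately have "cpsh_on T (\<lambda>x. ln (max (norm (f x)) \<delta>))"
      using \<open>\<delta> > 0\<close> by (elim cpsh_on_cong) (auto simp: max_def)
    with T show ?thesis by blast
  qed
qed

section \<open>Extended-real circle means and decreasing limits\<close>

lemma ereal_integral_continuous:
  assumes cont: "continuous_on UNIV g"
  shows "ereal_integral (uniform_measure lborel {0..2*pi}) (\<lambda>t. ereal (g t)) = ereal (avg g)"
proof -
  define M where "M = uniform_measure lborel {0..2*pi}"
  \<comment> \<open>The nonnegative case. It is applied below to the positive and the negative part
    of \<open>g\<close>, whose integrals are both finite.\<close>
  have nn: "(\<integral>\<^sup>+ t. ennreal (h t) \<partial>M) = ennreal (avg h)"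
    if h: "continuous_on UNIV h" "\<And>t. h t \<ge> 0" for h :: "real \<Rightarrow> real"
  proof -
    have [measurable]: "h \<in> borel_measurable borel"
      using h(1) by (rule borel_measurable_continuous_onI)
    have "(h has_integral integral {0..2*pi} h) {0..2*pi}"
      by (intro integrable_integral integrable_continuous_real continuous_on_subset[OF h(1)]) auto
    then have "(\<integral>\<^sup>+ t. ennreal (indicator {0..2*pi} t * h t) \<partial>lborel) = ennreal (integral {0..2*pi} h)"
      by (rule nn_integral_has_integral_lebesgue[rotated]) (use h in auto)
    moreover have "(\<integral>\<^sup>+ t. ennreal (h t) \<partial>M) =
        (\<integral>\<^sup>+ t. ennreal (h t) * indicator {0..2*pi} t \<partial>lborel) / emeasure lborel {0..2*pi}"
      unfolding M_def by (rule nn_integral_uniform_measure) auto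
    moreover have "ennreal (h t) * indicator {0..2*pi} t = ennreal (indicator {0..2*pi} t * h t)" for t
      by (auto simp: indicator_def)
    ultimately show ?thesis
      by (simp add: avg_def divide_ennreal integral_nonneg h
          integrable_continuous_real continuous_on_subset[OF h(1)])
  qed
  have ennreal_max: "ennreal (max 0 x) = ennreal x" for x
    by (simp add: max_def ennreal_neg)
  have pos: "(\<integral>\<^sup>+ t. ennreal (g t) \<partial>M) = ennreal (avg (\<lambda>t. max 0 (g t)))"
    using nn[of "\<lambda>t. max 0 (g t)"] cont by (simp add: continuous_on_max ennreal_max)
  have neg: "(\<integral>\<^sup>+ t. ennreal (- g t) \<partial>M) = ennreal (avg (\<lambda>t. max 0 (- g t)))"
    using nn[of "\<lambda>t. max 0 (- g t)"] cont
    by (simp add: continuous_on_max continuous_on_minus ennreal_max)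
  have avg_pos: "avg f \<ge> 0" if "continuous_on UNIV f" "\<And>t. f t \<ge> 0" for f
    unfolding avg_def
    by (intro divide_nonneg_nonneg integral_nonneg integrable_continuous_real continuous_on_subset[OF that(1)])
       (use that in auto)
  have "avg g = avg (\<lambda>t. max 0 (g t) + (-1) * max 0 (- g t))"
    by (rule arg_cong[where f = avg]) (auto simp: max_def)
  also have "\<dots> = avg (\<lambda>t. max 0 (g t)) + (-1) * avg (\<lambda>t. max 0 (- g t))"
    unfolding avg_mult_left[symmetric]
    by (intro avg_add continuous_intros continuous_on_subset[OF cont]) auto
  finally show ?thesis
    using cont unfolding M_def[symmetric]
    by (simp add: ereal_integral_def pos neg avg_pos continuous_on_max continuous_on_minus)
qed

lemma circle_mean_continuous:
  assumes "continuous_on S p" "\<And>\<zeta>. cmod \<zeta> \<le> 1 \<Longrightarrow> a + \<zeta> *s b \<in> S"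
  shows "circle_mean (\<lambda>x. ereal (p x)) a b = ereal (avg (\<lambda>t. p (a + cis t *s b)))"
  unfolding circle_mean_def
  by (intro ereal_integral_continuous continuous_on_circle[OF assms])

lemma plurisubharmonic_on_imp_cpsh_on:
  assumes "plurisubharmonic_on S (\<lambda>x. ereal (p x))" "continuous_on S p"
  shows "cpsh_on S p"
proof (rule cpsh_onI[OF assms(2)])
  fix a b :: "complex^'a"
  assume *: "\<And>\<zeta>. cmod \<zeta> \<le> 1 \<Longrightarrow> a + \<zeta> *s b \<in> S"
  then have "ereal (p a) \<le> circle_mean (\<lambda>x. ereal (p x)) a b"
    using assms(1) by (auto simp: plurisubharmonic_on_def)
  then show "p a \<le> avg (\<lambda>t. p (a + cis t *s b))"
    by (simp add: circle_mean_continuous[OF assms(2) *])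
qed

text \<open>The circle means of the \<open>p k\<close> converge to that of the infimum: dominated
  convergence handles the positive parts, monotone convergence the negative ones. The limit may take
  the value \<open>-\<infinity>\<close>.\<close>

lemma plurisubharmonic_on_INF:
  assumes p: "\<And>k. cpsh_on S (p k)"
    and decr: "\<And>k x. x \<in> S \<Longrightarrow> p (Suc k) x \<le> p k x"
  shows "plurisubharmonic_on S (\<lambda>x. INF k. ereal (p k x))"
  unfolding plurisubharmonic_on_def
proof (intro conjI ballI allI impI)
  fix x assume "x \<in> S"
  have "(INF k. ereal (p k x)) \<le> ereal (p 0 x)" by (rule INF_lower) auto
  then show "(INF k. ereal (p k x)) < \<infinity>" by (rule le_less_trans) simp
next
  fix r :: ereal
  have "openin (top_of_set S) {x\<in>S. ereal (p k x) < r}" for k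
  proof -
    have "{x\<in>S. ereal (p k x) < r} = S \<inter> p k -` (ereal -` {..<r})" by auto
    moreover have "open (ereal -` {..<r})"
      by (intro open_vimage continuous_intros)
    ultimately show ?thesis
      using continuous_openin_preimage_gen[OF cpsh_on_imp_continuous[OF p[of k]]] by auto
  qed
  then have "openin (top_of_set S) (\<Union>k. {x\<in>S. ereal (p k x) < r})" by blast
  also have "(\<Union>k. {x\<in>S. ereal (p k x) < r}) = {x\<in>S. (INF k. ereal (p k x)) < r}"
    by (auto simp: INF_less_iff)
  finally show "openin (top_of_set S) {x\<in>S. (INF k. ereal (p k x)) < r}" .
next
  fix a b :: "complex^'a"
  assume *: "\<forall>\<zeta>. cmod \<zeta> \<le> 1 \<longrightarrow> a + \<zeta> *s b \<in> S"
  define M where "M = uniform_measure lborel {0..2*pi}"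
  define g where "g k t = p k (a + cis t *s b)" for k t
  define G where "G t = (INF k. ereal (g k t))" for t
  have contg: "continuous_on T (g k)" for T k
    unfolding g_def by (rule continuous_on_circle[OF cpsh_on_imp_continuous[OF p]]) (use * in auto)
  have [measurable]: "g k \<in> borel_measurable M" for k
    using borel_measurable_continuous_onI[OF contg] by (simp add: M_def)
  have decg: "g (Suc k) t \<le> g k t" for k t
    unfolding g_def by (rule decr) (use * in auto)
  have lim: "(\<lambda>k. ereal (g k t)) \<longlonglongrightarrow> G t" for t
    unfolding G_def by (intro LIMSEQ_INF decseq_SucI) (simp add: decg)
  have pos: "(\<lambda>k. \<integral>\<^sup>+ t. ennreal (g k t) \<partial>M) \<longlonglongrightarrow> (\<integral>\<^sup>+ t. e2ennreal (G t) \<partial>M)"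
  proof (rule nn_integral_dominated_convergence[where w = "\<lambda>t. ennreal (g 0 t)"])
    have "ereal_integral M (\<lambda>t. ereal (g 0 t)) = ereal (avg (g 0))"
      unfolding M_def by (rule ereal_integral_continuous[OF contg])
    \<comment> \<open>In \<open>ereal\<close>, \<open>\<infinity> - x\<close> is
      \<open>\<infinity>\<close> for every \<open>x\<close>; so a real value of
      \<open>ereal_integral\<close> forces the positive part to have a finite integral.\<close>
    then have "enn2ereal (\<integral>\<^sup>+ t. ennreal (g 0 t) \<partial>M) \<noteq> \<infinity>"
      by (auto simp: ereal_integral_def)
    then show "(\<integral>\<^sup>+ t. ennreal (g 0 t) \<partial>M) < \<infinity>"
      by (metis enn2ereal_top infinity_ennreal_def top.not_eq_extremum)
    show "AE t in M. ennreal (g k t) \<le> ennreal (g 0 t)" for k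
      by (intro AE_I2 ennreal_leI) (induction k; use decg order.trans in blast)
    show "AE t in M. (\<lambda>k. ennreal (g k t)) \<longlonglongrightarrow> e2ennreal (G t)"
      using tendsto_e2ennrealI[OF lim] by simp
    show "(\<lambda>t. e2ennreal (G t)) \<in> borel_measurable M"
      unfolding G_def by measurable
  qed auto
  \<comment> \<open>The negative parts increase with \<open>k\<close>, so no bound is required and
    their limit may have an infinite integral.\<close>
  have neg: "(\<lambda>k. \<integral>\<^sup>+ t. ennreal (- g k t) \<partial>M) \<longlonglongrightarrow> (\<integral>\<^sup>+ t. e2ennreal (- G t) \<partial>M)"
  proof (rule nn_integral_LIMSEQ)
    show "incseq (\<lambda>k t. ennreal (- g k t))"
      by (intro incseq_SucI le_funI ennreal_leI) (simp add: decg)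
    show "(\<lambda>k. ennreal (- g k t)) \<longlonglongrightarrow> e2ennreal (- G t)" for t
      using tendsto_e2ennrealI[OF tendsto_uminus_ereal[OF lim]] by simp
  qed auto
  \<comment> \<open>Finiteness here excludes \<open>\<infinity> - \<infinity>\<close> when the two
    limits are subtracted.\<close>
  have "(\<integral>\<^sup>+ t. e2ennreal (G t) \<partial>M) \<noteq> \<infinity>"
  proof -
    have "(\<integral>\<^sup>+ t. e2ennreal (G t) \<partial>M) \<le> (\<integral>\<^sup>+ t. ennreal (g 0 t) \<partial>M)"
      by (intro nn_integral_mono) (metis G_def INF_lower UNIV_I e2ennreal_ereal e2ennreal_mono)
    moreover have "ereal_integral M (\<lambda>t. ereal (g 0 t)) = ereal (avg (g 0))"
      unfolding M_def by (rule ereal_integral_continuous[OF contg])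
    then have "(\<integral>\<^sup>+ t. ennreal (g 0 t) \<partial>M) \<noteq> \<infinity>"
      by (auto simp: ereal_integral_def)
    ultimately show ?thesis by (auto simp: top_unique)
  qed
  then have "(\<lambda>k. ereal_integral M (\<lambda>t. ereal (g k t))) \<longlonglongrightarrow> ereal_integral M G"
    using pos neg unfolding ereal_integral_def
    by (intro tendsto_diff_ereal_general) (auto simp: enn2ereal_eq_top_iff)
  then have limit: "(\<lambda>k. ereal (avg (g k))) \<longlonglongrightarrow> circle_mean (\<lambda>x. INF k. ereal (p k x)) a b"
    unfolding M_def circle_mean_def G_def[abs_def] g_def[abs_def]
    using ereal_integral_continuous[OF contg] by (simp add: g_def[abs_def])
  have "(INF k. ereal (p k a)) \<le> ereal (avg (g k))" for k
  proof -
    have "(INF k. ereal (p k a)) \<le> ereal (p k a)" by (rule INF_lower) auto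
    also have "p k a \<le> avg (g k)"
      unfolding g_def by (rule cpsh_onD[OF p]) (use * in auto)
    finally show ?thesis by simp
  qed
  then show "(INF k. ereal (p k a)) \<le> circle_mean (\<lambda>x. INF k. ereal (p k x)) a b"
    by (intro tendsto_lowerbound[OF limit] always_eventually) auto
qed

section \<open>Charts\<close>

lemma holomorphic_map_on_compose:
  assumes "holomorphic_map_on f S" "holomorphic_map_on g T" "f ` S \<subseteq> T"
  shows "holomorphic_map_on (g \<circ> f) S"
  unfolding holomorphic_map_on_def
proof
  fix x assume "x \<in> S"
  with assms obtain D E where D: "(f has_derivative D) (at x)" "\<And>c v. D (c *s v) = c *s D v"
    and E: "(g has_derivative E) (at (f x))" "\<And>c v. E (c *s v) = c *s E v"
    unfolding holomorphic_map_on_def by (meson image_subset_iff)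
  from diff_chain_at[OF D(1) E(1)] D(2) E(2)
  show "\<exists>D. (g \<circ> f has_derivative D) (at x) \<and> (\<forall>c v. D (c *s v) = c *s D v)"
    by (intro exI[of _ "E \<circ> D"]) auto
qed

text \<open>Derivatives depend only on values near the point. This serves to exchange expressions
  with \<open>inv_into\<close> that agree merely on the open image of a chart.\<close>

lemma holomorphic_map_on_transform:
  assumes "holomorphic_map_on f S" "open T" "S \<subseteq> T" "\<And>x. x \<in> T \<Longrightarrow> f x = g x"
  shows "holomorphic_map_on g S"
  unfolding holomorphic_map_on_def
proof
  fix x assume "x \<in> S"
  with assms(1) obtain D where D: "(f has_derivative D) (at x)" "\<forall>c v. D (c *s v) = c *s D v"
    by (auto simp: holomorphic_map_on_def)
  have "(g has_derivative D) (at x)"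
    by (rule has_derivative_transform_within_open[OF D(1) assms(2)]) (use assms \<open>x \<in> S\<close> in auto)
  with D(2) show "\<exists>D. (g has_derivative D) (at x) \<and> (\<forall>c v. D (c *s v) = c *s D v)" by blast
qed

lemma holomorphic_map_on_diff_const:
  assumes "holomorphic_map_on f S"
  shows "holomorphic_map_on (\<lambda>x. f x - c) S"
  unfolding holomorphic_map_on_def
proof
  fix x assume "x \<in> S"
  with assms obtain D where D: "(f has_derivative D) (at x)" "\<forall>c v. D (c *s v) = c *s D v"
    by (auto simp: holomorphic_map_on_def)
  have "((\<lambda>x. f x - c) has_derivative D) (at x)"
    using has_derivative_diff[OF D(1) has_derivative_const[of c]] by simp
  with D(2) show "\<exists>D. ((\<lambda>x. f x - c) has_derivative D) (at x) \<and> (\<forall>c v. D (c *s v) = c *s D v)"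
    by blast
qed

section \<open>Charts as homeomorphisms, their restrictions and transition maps\<close>

lemma topological_chartD:
  assumes "topological_chart X (U, \<phi>)"
  shows "openin X U" "U \<subseteq> topspace X" "topspace (subtopology X U) = U" "open (\<phi> ` U)"
    "homeomorphic_map (subtopology X U) (top_of_set (\<phi> ` U)) \<phi>" "inj_on \<phi> U"
proof -
  show U: "openin X U" "open (\<phi> ` U)"
    "homeomorphic_map (subtopology X U) (top_of_set (\<phi> ` U)) \<phi>"
    using assms by (auto simp: topological_chart_def)
  show "U \<subseteq> topspace X" using U(1) by (rule openin_subset)
  then show "topspace (subtopology X U) = U" by auto
  then show "inj_on \<phi> U" using homeomorphic_imp_injective_map[OF U(3)] by simp
qed

text \<open>The homeomorphism comes with some continuous inverse; injectivity identifies it with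
  \<open>inv_into U \<phi>\<close> on the image.\<close>

lemma topological_chart_inverse:
  assumes "topological_chart X (U, \<phi>)"
  shows "continuous_map (top_of_set (\<phi> ` U)) (subtopology X U) (inv_into U \<phi>)"
proof -
  note c = topological_chartD[OF assms]
  obtain g where g: "homeomorphic_maps (subtopology X U) (top_of_set (\<phi> ` U)) \<phi> g"
    using c(5) unfolding homeomorphic_map_maps by blast
  have "continuous_map (top_of_set (\<phi> ` U)) (subtopology X U) g"
    using g by (simp add: homeomorphic_maps_def)
  moreover have "g x = inv_into U \<phi> x" if "x \<in> topspace (top_of_set (\<phi> ` U))" for x
  proof -
    obtain z where "z \<in> U" "x = \<phi> z" using \<open>x \<in> _\<close> by auto
    then show ?thesis using g c(3) c(6) by (simp add: homeomorphic_maps_def)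
  qed
  ultimately show ?thesis by (rule continuous_map_eq)
qed

lemma topological_chart_continuous:
  assumes "topological_chart X (U, \<phi>)"
  shows "continuous_map (subtopology X U) euclidean \<phi>"
  using homeomorphic_imp_continuous_map[OF topological_chartD(5)[OF assms]]
  by (simp add: continuous_map_in_subtopology)

lemma topological_chart_open_image:
  assumes "topological_chart X (U, \<phi>)" "openin X N"
  shows "open (\<phi> ` (U \<inter> N))"
proof -
  note c = topological_chartD[OF assms(1)]
  have "openin (subtopology X U) (U \<inter> N)"
    using assms(2) by (rule openin_subtopology_Int2)
  then have "openin (top_of_set (\<phi> ` U)) (\<phi> ` (U \<inter> N))"
    using homeomorphic_imp_open_map[OF c(5)] by (simp add: open_map_def)
  then show ?thesis
    using c(4) by (rule openin_open_trans)
qed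

lemma topological_chart_openin_preimage:
  assumes "topological_chart X (U, \<phi>)" "open T"
  shows "openin X {z\<in>U. \<phi> z \<in> T}"
proof -
  have U: "openin X U" using assms(1) by (simp add: topological_chart_def)
  then have "topspace (subtopology X U) = U" by (auto dest: openin_subset)
  then have "openin (subtopology X U) {z\<in>U. \<phi> z \<in> T}"
    using openin_continuous_map_preimage[OF topological_chart_continuous[OF assms(1)], of T] assms(2) by simp
  then show ?thesis using U openin_trans_full by blast
qed

lemma topological_chart_continuous_on:
  fixes f :: "'a \<Rightarrow> real"
  assumes "topological_chart X (U, \<phi>)" "continuous_map (subtopology X N) euclideanreal f"
  shows "continuous_on (\<phi> ` (U \<inter> N)) (f \<circ> inv_into U \<phi>)"
proof -
  have inj: "inj_on \<phi> U" by (rule topological_chartD(6)[OF assms(1)])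
  have "continuous_map (top_of_set (\<phi> ` (U \<inter> N))) X (inv_into U \<phi>)"
    using continuous_map_from_subtopology[OF topological_chart_inverse[OF assms(1)], of "\<phi> ` (U \<inter> N)"]
    by (simp add: subtopology_subtopology continuous_map_in_subtopology Int_absorb1 image_mono)
  moreover have "inv_into U \<phi> ` \<phi> ` (U \<inter> N) \<subseteq> N" using inj by auto
  ultimately have "continuous_map (top_of_set (\<phi> ` (U \<inter> N))) (subtopology X N) (inv_into U \<phi>)"
    by (auto simp: continuous_map_in_subtopology)
  from continuous_map_compose[OF this assms(2)] show ?thesis by simp
qed

lemma topological_chart_restrict:
  assumes "topological_chart X (U, \<phi>)" "open T"
  shows "topological_chart X ({z\<in>U. \<phi> z \<in> T}, \<phi>)"
proof -
  let ?U = "{z\<in>U. \<phi> z \<in> T}"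
  have op: "openin X ?U" by (rule topological_chart_openin_preimage[OF assms])
  have im: "\<phi> ` ?U = \<phi> ` (U \<inter> ?U)" by auto
  have sub: "\<phi> ` ?U \<subseteq> \<phi> ` U" "?U \<subseteq> U" by auto
  have tU: "topspace (subtopology X U) = U" using assms(1)
    by (auto simp: topological_chart_def dest: openin_subset)
  have "homeomorphic_map (subtopology (subtopology X U) ?U) (subtopology (top_of_set (\<phi> ` U)) (\<phi> ` ?U)) \<phi>"
    by (rule homeomorphic_map_subtopologies) (use assms(1) tU in \<open>auto simp: topological_chart_def\<close>)
  then have "homeomorphic_map (subtopology X ?U) (top_of_set (\<phi> ` ?U)) \<phi>"
    using sub by (simp add: subtopology_subtopology Int_absorb1 del: image_subset_iff)
  moreover have "open (\<phi> ` ?U)"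
    unfolding im by (rule topological_chart_open_image[OF assms(1) op])
  ultimately show ?thesis using op by (simp add: topological_chart_def)
qed

text \<open>Coordinate neighborhoods may be shrunk, both for the logarithmic pole and for the final
  neighborhood. As \<open>inv_into\<close> depends on the domain, compatibility has to be
  transferred along the agreement of the two inverses on the smaller image.\<close>

lemma holomorphic_chart_restrict:
  assumes c: "(U, \<phi>) \<in> holomorphic_charts X A" and "open T"
  shows "({z\<in>U. \<phi> z \<in> T}, \<phi>) \<in> holomorphic_charts X A"
proof -
  let ?U = "{z\<in>U. \<phi> z \<in> T}"
  have top: "topological_chart X (U, \<phi>)" using c by (simp add: holomorphic_charts_def)
  have top': "topological_chart X (?U, \<phi>)" by (rule topological_chart_restrict[OF top \<open>open T\<close>])
  have inj: "inj_on \<phi> U" by (rule topological_chartD(6)[OF top])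
  have "compatible_charts (?U, \<phi>) (V, \<psi>)" if "(V, \<psi>) \<in> A" for V \<psi>
  proof -
    have compat: "compatible_charts (U, \<phi>) (V, \<psi>)" using c that by (auto simp: holomorphic_charts_def)
    have 1: "holomorphic_map_on (\<psi> \<circ> inv_into U \<phi>) (\<phi> ` (?U \<inter> V))"
      using compat by (auto simp: compatible_charts_def elim!: holomorphic_map_on_subset)
    have 2: "holomorphic_map_on (\<phi> \<circ> inv_into V \<psi>) (\<psi> ` (?U \<inter> V))"
      using compat by (auto simp: compatible_charts_def elim!: holomorphic_map_on_subset)
    have "inv_into ?U \<phi> x = inv_into U \<phi> x" if x: "x \<in> \<phi> ` ?U" for x
    proof -
      obtain z where "z \<in> ?U" "x = \<phi> z" using x by blast
      then show ?thesis using inv_into_f_f[OF inj] inv_into_f_f[OF inj_on_subset[OF inj, of ?U]] by auto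
    qed
    then have "holomorphic_map_on (\<psi> \<circ> inv_into ?U \<phi>) (\<phi> ` (?U \<inter> V))"
      by (intro holomorphic_map_on_transform[OF 1, of "\<phi> ` ?U"])
         (use top' in \<open>auto simp: topological_chart_def\<close>)
    with 2 show ?thesis by (simp add: compatible_charts_def)
  qed
  with top' show ?thesis by (auto simp: holomorphic_charts_def)
qed

text \<open>Members of the maximal atlas are by definition compared only with charts from
  \<open>A\<close>. Near each point the transition map factors through such a chart.\<close>

lemma holomorphic_charts_transition:
  assumes M: "complex_manifold X A"
    and c: "(U, \<phi>) \<in> holomorphic_charts X A" and d: "(V, \<psi>) \<in> holomorphic_charts X A"
  shows "holomorphic_map_on (\<phi> \<circ> inv_into V \<psi>) (\<psi> ` (V \<inter> U))"
  unfolding holomorphic_map_on_def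
proof
  have cU: "topological_chart X (U, \<phi>)" and cV: "topological_chart X (V, \<psi>)"
    using c d by (auto simp: holomorphic_charts_def)
  note U = topological_chartD[OF cU] and V = topological_chartD[OF cV]
  fix x assume "x \<in> \<psi> ` (V \<inter> U)"
  then obtain z where z: "z \<in> V" "z \<in> U" "x = \<psi> z" by blast
  have "z \<in> (\<Union>c\<in>A. fst c)" using M z(1) V(2) by (auto simp: complex_manifold_def)
  then obtain W \<eta> where W: "(W, \<eta>) \<in> A" "z \<in> W" by auto
  then have cW: "topological_chart X (W, \<eta>)" using M by (auto simp: complex_manifold_def)
  note W' = topological_chartD[OF cW]
  have 1: "holomorphic_map_on (\<eta> \<circ> inv_into V \<psi>) (\<psi> ` (V \<inter> W))"
    using d W(1) by (auto simp: holomorphic_charts_def compatible_charts_def)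
  have 2: "holomorphic_map_on (\<phi> \<circ> inv_into W \<eta>) (\<eta> ` (W \<inter> U))"
    using c W(1) by (auto simp: holomorphic_charts_def compatible_charts_def Int_commute)
  let ?N = "\<psi> ` (V \<inter> (U \<inter> W))"
  have "holomorphic_map_on (\<eta> \<circ> inv_into V \<psi>) ?N"
    by (rule holomorphic_map_on_subset[OF 1]) auto
  moreover have "(\<eta> \<circ> inv_into V \<psi>) ` ?N \<subseteq> \<eta> ` (W \<inter> U)"
    using V(6) by auto
  ultimately have "holomorphic_map_on ((\<phi> \<circ> inv_into W \<eta>) \<circ> (\<eta> \<circ> inv_into V \<psi>)) ?N"
    by (intro holomorphic_map_on_compose[OF _ 2])
  then have "holomorphic_map_on (\<phi> \<circ> inv_into V \<psi>) ?N"
  proof (rule holomorphic_map_on_transform)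
    show "open ?N" using U(1) W'(1) by (intro topological_chart_open_image[OF cV] openin_Int)
    show "((\<phi> \<circ> inv_into W \<eta>) \<circ> (\<eta> \<circ> inv_into V \<psi>)) y = (\<phi> \<circ> inv_into V \<psi>) y" if y: "y \<in> ?N" for y
    proof -
      obtain v where "v \<in> V" "v \<in> W" "y = \<psi> v" using y by blast
      then show ?thesis using V(6) W'(6) by simp
    qed
  qed auto
  then show "\<exists>D. (\<phi> \<circ> inv_into V \<psi> has_derivative D) (at x) \<and> (\<forall>c v. D (c *s v) = c *s D v)"
    using z W(2) unfolding holomorphic_map_on_def by blast
qed

section \<open>Continuous plurisubharmonic functions on a manifold\<close>

definition cpsh_in ::
    "'a topology \<Rightarrow> ('a, 'n::finite) chart set \<Rightarrow> 'a set \<Rightarrow> ('a \<Rightarrow> real) \<Rightarrow> bool" where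
  "cpsh_in X A N f \<longleftrightarrow> openin X N \<and>
     (\<forall>(V, \<psi>)\<in>holomorphic_charts X A. cpsh_on (\<psi> ` (V \<inter> N)) (f \<circ> inv_into V \<psi>))"

lemma cpsh_inI:
  assumes "openin X N"
    and "\<And>V \<psi>. (V, \<psi>) \<in> holomorphic_charts X A \<Longrightarrow> cpsh_on (\<psi> ` (V \<inter> N)) (f \<circ> inv_into V \<psi>)"
  shows "cpsh_in X A N f"
  using assms by (auto simp: cpsh_in_def)

lemma cpsh_inD:
  assumes "cpsh_in X A N f" "(V, \<psi>) \<in> holomorphic_charts X A"
  shows "cpsh_on (\<psi> ` (V \<inter> N)) (f \<circ> inv_into V \<psi>)"
  using assms by (auto simp: cpsh_in_def)

lemma cpsh_in_openin: "cpsh_in X A N f \<Longrightarrow> openin X N"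
  by (simp add: cpsh_in_def)

lemma cpsh_in_subset:
  assumes "cpsh_in X A N f" "openin X N'" "N' \<subseteq> N"
  shows "cpsh_in X A N' f"
  by (rule cpsh_inI[OF assms(2)], rule cpsh_on_subset[OF cpsh_inD[OF assms(1)]])
     (use assms(3) in auto)

lemma cpsh_in_cong:
  assumes "cpsh_in X A N f" "\<And>z. z \<in> N \<Longrightarrow> f z = g z"
  shows "cpsh_in X A N g"
proof (rule cpsh_inI[OF cpsh_in_openin[OF assms(1)]])
  fix V \<psi> assume c: "(V, \<psi>) \<in> holomorphic_charts X A"
  then have inj: "inj_on \<psi> V" by (auto simp: holomorphic_charts_def dest: topological_chartD)
  show "cpsh_on (\<psi> ` (V \<inter> N)) (g \<circ> inv_into V \<psi>)"
    by (rule cpsh_on_cong[OF cpsh_inD[OF assms(1) c]]) (use inj assms(2) in auto)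
qed

lemma cpsh_in_const: "openin X N \<Longrightarrow> cpsh_in X A N (\<lambda>z. c)"
  by (rule cpsh_inI) (auto simp: o_def)

lemma cpsh_in_add: "cpsh_in X A N f \<Longrightarrow> cpsh_in X A N g \<Longrightarrow> cpsh_in X A N (\<lambda>z. f z + g z)"
  unfolding cpsh_in_def o_def by (auto intro!: cpsh_on_add)

lemma cpsh_in_scale: "cpsh_in X A N f \<Longrightarrow> c \<ge> 0 \<Longrightarrow> cpsh_in X A N (\<lambda>z. c * f z)"
  unfolding cpsh_in_def o_def by (auto intro!: cpsh_on_scale)

lemma cpsh_in_max: "cpsh_in X A N f \<Longrightarrow> cpsh_in X A N g \<Longrightarrow> cpsh_in X A N (\<lambda>z. max (f z) (g z))"
  unfolding cpsh_in_def o_def by (auto intro!: cpsh_on_max)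

text \<open>The gluing principle on the manifold, obtained from \<open>cpsh_on_local\<close> in each
  chart.\<close>

lemma cpsh_in_local:
  assumes "openin X N" "\<And>z. z \<in> N \<Longrightarrow> \<exists>N'. z \<in> N' \<and> cpsh_in X A N' f"
  shows "cpsh_in X A N f"
proof (rule cpsh_inI[OF assms(1)], rule cpsh_on_local)
  fix V \<psi> x assume c: "(V, \<psi>) \<in> holomorphic_charts X A" and "x \<in> \<psi> ` (V \<inter> N)"
  then obtain z where z: "z \<in> V" "z \<in> N" "x = \<psi> z" by blast
  with assms(2) obtain N' where N': "z \<in> N'" "cpsh_in X A N' f" by blast
  have "topological_chart X (V, \<psi>)" using c by (simp add: holomorphic_charts_def)
  then have "open (\<psi> ` (V \<inter> N'))"
    using cpsh_in_openin[OF N'(2)] by (rule topological_chart_open_image)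
  then show "\<exists>T. open T \<and> x \<in> T \<and> cpsh_on T (f \<circ> inv_into V \<psi>)"
    using cpsh_inD[OF N'(2) c] z N'(1) by blast
qed

lemma psh_on_imp_cpsh_in:
  assumes "psh_on X A N (\<lambda>z. ereal (f z))" "continuous_map (subtopology X N) euclideanreal f"
  shows "cpsh_in X A N f"
proof (rule cpsh_inI)
  show "openin X N" using assms(1) by (simp add: psh_on_def)
  fix V \<psi> assume c: "(V, \<psi>) \<in> holomorphic_charts X A"
  then have "plurisubharmonic_on (\<psi> ` (V \<inter> N)) (\<lambda>x. ereal ((f \<circ> inv_into V \<psi>) x))"
    using assms(1) by (auto simp: psh_on_def o_def)
  moreover have "continuous_on (\<psi> ` (V \<inter> N)) (f \<circ> inv_into V \<psi>)"
    by (rule topological_chart_continuous_on[OF _ assms(2)]) (use c in \<open>simp add: holomorphic_charts_def\<close>)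
  ultimately show "cpsh_on (\<psi> ` (V \<inter> N)) (f \<circ> inv_into V \<psi>)"
    by (rule plurisubharmonic_on_imp_cpsh_on)
qed

lemma psh_on_INF:
  assumes f: "\<And>k. cpsh_in X A N (f k)"
    and decr: "\<And>k z. z \<in> N \<Longrightarrow> f (Suc k) z \<le> f k z"
  shows "psh_on X A N (\<lambda>z. INF k. ereal (f k z))"
  unfolding psh_on_def
proof (intro conjI ballI, safe)
  show "openin X N" using f by (rule cpsh_in_openin)
  fix V \<psi> assume c: "(V, \<psi>) \<in> holomorphic_charts X A"
  then have inj: "inj_on \<psi> V" by (auto simp: holomorphic_charts_def dest: topological_chartD)
  have "plurisubharmonic_on (\<psi> ` (V \<inter> N)) (\<lambda>x. INF k. ereal ((f k \<circ> inv_into V \<psi>) x))"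
    by (rule plurisubharmonic_on_INF[OF cpsh_inD[OF f c]]) (use decr inj in auto)
  then show "plurisubharmonic_on (\<psi> ` (V \<inter> N)) ((\<lambda>z. INF k. ereal (f k z)) \<circ> inv_into V \<psi>)"
    by (simp add: o_def)
qed

text \<open>In any other chart, \<open>\<phi>\<close> becomes a holomorphic transition map, and
  subtracting \<open>p\<close> keeps it holomorphic.\<close>

lemma cpsh_in_ln_max_norm:
  assumes M: "complex_manifold X A" and c: "(U, \<phi>) \<in> holomorphic_charts X A" and "\<delta> > 0"
  shows "cpsh_in X A U (\<lambda>z. ln (max (norm (\<phi> z - p)) \<delta>))"
proof (rule cpsh_inI)
  have top: "topological_chart X (U, \<phi>)" using c by (simp add: holomorphic_charts_def)
  show U: "openin X U" by (rule topological_chartD[OF top])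
  fix V \<psi> assume d: "(V, \<psi>) \<in> holomorphic_charts X A"
  then have "topological_chart X (V, \<psi>)" by (simp add: holomorphic_charts_def)
  then have "open (\<psi> ` (V \<inter> U))" using U by (rule topological_chart_open_image)
  from cpsh_on_ln_max_norm[OF holomorphic_map_on_diff_const[OF holomorphic_charts_transition[OF M c d]]
      this \<open>\<delta> > 0\<close>, of p]
  show "cpsh_on (\<psi> ` (V \<inter> U)) ((\<lambda>z. ln (max (norm (\<phi> z - p)) \<delta>)) \<circ> inv_into V \<psi>)"
    by (simp add: o_def)
qed

section \<open>The glued function\<close>

text \<open>The truncation levels tend to 0. For positive \<open>s\<close> some level lies below
  \<open>s\<close> and the truncation has no effect; otherwise the bounds tend to
  \<open>-\<infinity>\<close>, which is then the value of \<open>elog s\<close>.\<close>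

lemma INF_le_elog:
  assumes "\<And>k. q k \<le> ln (max s (\<rho> / (real k + 1))) + C" and "\<rho> > 0"
  shows "(INF k. ereal (q k)) \<le> elog s + ereal C"
proof -
  have ex: "\<exists>k. \<rho> / (real k + 1) < r" if "r > 0" for r
  proof -
    obtain k where "\<rho> / r < real k" using reals_Archimedean2 by blast
    then have "\<rho> / (real k + 1) < r" using that \<open>\<rho> > 0\<close>
      by (simp add: field_simps)
    then show ?thesis ..
  qed
  show ?thesis
  proof (cases "s > 0")
    case True
    with ex obtain k where "\<rho> / (real k + 1) < s" by blast
    then have "q k \<le> ln s + C" using assms(1)[of k] by (simp add: max_def)
    then have "ereal (q k) \<le> elog s + ereal C" using True by (simp add: elog_def)
    then show ?thesis by (meson INF_lower2 UNIV_I)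
  next
    case False
    have "(INF k. ereal (q k)) \<le> ereal B" for B
    proof -
      obtain k where k: "\<rho> / (real k + 1) < exp (B - C)" using ex[of "exp (B - C)"] by auto
      have "\<rho> / (real k + 1) > 0" using \<open>\<rho> > 0\<close> by simp
      then have "max s (\<rho> / (real k + 1)) = \<rho> / (real k + 1)" using False by (simp add: max_def)
      then have "q k \<le> ln (\<rho> / (real k + 1)) + C" using assms(1)[of k] by simp
      also have "ln (\<rho> / (real k + 1)) \<le> B - C"
        using k \<open>\<rho> / (real k + 1) > 0\<close> by (metis ln_exp ln_mono less_imp_le)
      finally have "ereal (q k) \<le> ereal B" by simp
      then show ?thesis by (meson INF_lower2 UNIV_I)
    qed
    then have "(INF k. ereal (q k)) = -\<infinity>"
      using ereal_bot by blast
    then show ?thesis by simp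
  qed
qed

lemma ln_ge_one_minus_inverse: "x > 0 \<Longrightarrow> ln x \<ge> 1 - 1 / (x::real)"
  using ln_le_minus_one[of "1 / x"] by (simp add: ln_div)

text \<open>The set is the continuous image of a compact ball, and compact sets are closed in a
  Hausdorff space. It makes the outer piece of the gluing open.\<close>

lemma closedin_chart_cball:
  assumes "Hausdorff_space X" "topological_chart X (U, \<phi>)" "cball p r \<subseteq> \<phi> ` U"
  shows "closedin X {z\<in>U. \<phi> z \<in> cball p r}"
proof -
  note c = topological_chartD[OF assms(2)]
  have "compactin (top_of_set (\<phi> ` U)) (cball p r)"
    using assms(3) by (simp add: compactin_subtopology)
  from image_compactin[OF this topological_chart_inverse[OF assms(2)]]
  have "compactin X (inv_into U \<phi> ` cball p r)"
    by (simp add: compactin_subtopology)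
  moreover have "inv_into U \<phi> ` cball p r = {z\<in>U. \<phi> z \<in> cball p r}"
  proof safe
    fix x assume "x \<in> cball p r"
    then have "x \<in> \<phi> ` U" using assms(3) by blast
    then show "inv_into U \<phi> x \<in> U" "\<phi> (inv_into U \<phi> x) \<in> cball p r"
      using \<open>x \<in> cball p r\<close> by (simp_all add: inv_into_into f_inv_into_f)
  next
    fix z assume "z \<in> U" "\<phi> z \<in> cball p r"
    then show "z \<in> inv_into U \<phi> ` cball p r" using c(6) by (metis image_eqI inv_into_f_f)
  qed
  ultimately show ?thesis using compactin_imp_closedin[OF assms(1)] by simp
qed

text \<open>The constant involves neither \<open>w\<close> nor \<open>z0\<close>: this is the
  uniformity demanded by the theorem. The competitor \<open>v\<close> below is the limit of the
  glued functions \<open>g k\<close>, lowered by \<open>C\<close>.\<close>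

lemma green_function_lower_bound:
  fixes X :: "'a topology" and A :: "('a, 'n::finite) chart set" and u :: "'a \<Rightarrow> real"
  assumes M: "complex_manifold X A"
    and cont: "continuous_map X euclideanreal u"
    and bound: "\<And>z. z \<in> topspace X \<Longrightarrow> \<bar>u z\<bar> \<le> B"
    and psh: "psh X A (\<lambda>z. ereal (u z))"
    and c: "(U, \<phi>) \<in> holomorphic_charts X A"
    and "\<epsilon> > 0"
    and spsh: "psh_on X A U (\<lambda>z. ereal (u z) - ereal (\<epsilon> * (norm (\<phi> z - \<phi> w0))\<^sup>2))"
    and "\<rho> > 0" and sub: "cball (\<phi> w0) (2 * \<rho>) \<subseteq> \<phi> ` U"
    and w: "w \<in> U" "norm (\<phi> w - \<phi> w0) < \<rho> / 16"
    and z0: "z0 \<in> U" "norm (\<phi> z0 - \<phi> w0) < \<rho>"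
  shows "green_function X A z0 w \<ge>
    elog (norm (\<phi> z0 - \<phi> w)) + ereal (- ln \<rho> - 2 * B / (\<epsilon> * \<rho>\<^sup>2) - 2)"
proof -
  have top: "topological_chart X (U, \<phi>)" using c by (simp add: holomorphic_charts_def)
  note U = topological_chartD[OF top]
  define a where "a = 1 / (\<epsilon> * \<rho>\<^sup>2)"
  have a: "a > 0" using \<open>\<epsilon> > 0\<close> \<open>\<rho> > 0\<close> by (simp add: a_def)
  define \<tau> where "\<tau> z = norm (\<phi> z - \<phi> w0) / \<rho>" for z
  define l where "l k z = ln (max (norm (\<phi> z - \<phi> w)) (\<rho> / (real k + 1))) - ln \<rho>" for k z
  define F where "F k z = l k z - (\<tau> z)\<^sup>2 + a * u z + 2" for k z
  \<comment> \<open>Anything above \<open>a * B + 9/4\<close> makes \<open>v\<close> negative, by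
    \<open>F_upper\<close>.\<close>
  define C where "C = a * B + 3"
  define g where "g k z = (if z \<in> U \<and> \<tau> z < 1 then F k z
    else if z \<in> U \<and> \<tau> z < 2 then max (F k z) (a * u z) else a * u z)" for k z
  define v where "v z = (INF k. ereal (g k z - C))" for z
  have au: "\<bar>a * u z\<bar> \<le> a * B" if "z \<in> topspace X" for z
    using bound[OF that] a by (simp add: abs_mult)
  have l_decr: "l (Suc k) z \<le> l k z" for k z
  proof -
    have "\<rho> / (real (Suc k) + 1) \<le> \<rho> / (real k + 1)"
      using \<open>\<rho> > 0\<close> by (intro divide_left_mono) auto
    moreover have "\<rho> / (real (Suc k) + 1) > 0" using \<open>\<rho> > 0\<close> by simp
    ultimately show ?thesis unfolding l_def by (intro diff_right_mono ln_mono) auto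
  qed
  have s_lower: "norm (\<phi> z - \<phi> w) / \<rho> \<ge> \<tau> z - 1/16"
    and s_upper: "norm (\<phi> z - \<phi> w) / \<rho> \<le> \<tau> z + 1/16" for z
  proof -
    have "norm (\<phi> w - \<phi> w0) / \<rho> < 1/16"
      using w(2) \<open>\<rho> > 0\<close> by (simp add: field_simps)
    moreover have "\<tau> z \<le> (norm (\<phi> z - \<phi> w) + norm (\<phi> w - \<phi> w0)) / \<rho>"
      unfolding \<tau>_def using norm_triangle_ineq[of "\<phi> z - \<phi> w" "\<phi> w - \<phi> w0"] \<open>\<rho> > 0\<close>
      by (intro divide_right_mono) auto
    moreover have "norm (\<phi> z - \<phi> w) / \<rho> \<le> (norm (\<phi> z - \<phi> w0) + norm (\<phi> w - \<phi> w0)) / \<rho>"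
      using norm_triangle_ineq4[of "\<phi> z - \<phi> w0" "\<phi> w - \<phi> w0"] \<open>\<rho> > 0\<close>
      by (intro divide_right_mono) auto
    ultimately show "norm (\<phi> z - \<phi> w) / \<rho> \<ge> \<tau> z - 1/16" "norm (\<phi> z - \<phi> w) / \<rho> \<le> \<tau> z + 1/16"
      unfolding \<tau>_def add_divide_distrib by linarith+
  qed
  \<comment> \<open>The rescaled truncated distance, for which \<open>l k\<close> is a plain
    logarithm and the truncation level is at most 1.\<close>
  define m where "m k z = max (norm (\<phi> z - \<phi> w) / \<rho>) (1 / (real k + 1))" for k z
  have l_m: "l k z = ln (m k z)" for k z
  proof -
    have pos: "max (norm (\<phi> z - \<phi> w)) (\<rho> / (real k + 1)) > 0"
      using \<open>\<rho> > 0\<close> by (simp add: less_max_iff_disj)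
    have "m k z = max (norm (\<phi> z - \<phi> w)) (\<rho> / (real k + 1)) / \<rho>"
      using \<open>\<rho> > 0\<close> by (simp add: m_def max_divide_distrib_right)
    then show ?thesis using pos \<open>\<rho> > 0\<close> by (simp add: l_def ln_div)
  qed
  have m_pos: "m k z > 0" for k z
    by (simp add: m_def less_max_iff_disj)
  have m_upper: "m k z \<le> \<tau> z + 1" for k z
  proof -
    have "1 / (real k + 1) \<le> 1" by simp
    moreover have "\<tau> z \<ge> 0" using \<open>\<rho> > 0\<close> by (simp add: \<tau>_def)
    ultimately show ?thesis unfolding m_def using s_upper[of z] by (intro max.boundedI) linarith+
  qed
  \<comment> \<open>Here \<open>m k z > 3/4 - 1/16 = 11/16\<close>, so \<open>l k z > -5/11\<close>;
    with \<open>(\<tau> z)\<^sup>2 \<le> 1\<close> the excess over \<open>a * u z\<close> is more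
    than \<open>6/11\<close>.\<close>
  have F_inner: "F k z > a * u z" if "\<tau> z > 3/4" "\<tau> z \<le> 1" for k z
  proof -
    have m: "m k z > 11/16"
      unfolding m_def less_max_iff_disj using s_lower[of z] that by linarith
    have "1 / m k z < 16/11" using m by (simp add: field_simps)
    then have "l k z > 1 - 16/11"
      unfolding l_m using ln_ge_one_minus_inverse[OF m_pos, of k z] by linarith
    moreover have "(\<tau> z)\<^sup>2 \<le> 1" using that by (simp add: power_le_one)
    ultimately show ?thesis by (simp add: F_def)
  qed
  \<comment> \<open>From \<open>ln x \<le> x - 1\<close> and
    \<open>(\<tau> z)\<^sup>2 \<ge> 7/4 * \<tau> z\<close>, the difference to \<open>a * u z\<close>
    is at most \<open>17/16 - 3/4 * \<tau> z\<close>, which is at most \<open>-1/4\<close>.\<close>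
  have F_outer: "F k z \<le> a * u z" if "\<tau> z \<ge> 7/4" for k z
  proof -
    have "1 / (real k + 1) \<le> 1" by simp
    then have "m k z \<le> \<tau> z + 1/16"
      unfolding m_def using s_upper[of z] that by (intro max.boundedI) linarith+
    then have "l k z \<le> \<tau> z + 1/16 - 1"
      unfolding l_m using ln_le_minus_one[OF m_pos, of k z] by linarith
    moreover have "(\<tau> z)\<^sup>2 \<ge> 7/4 * \<tau> z"
      using that by (simp add: power2_eq_square mult_right_mono)
    ultimately show ?thesis using that by (simp add: F_def)
  qed
  have F_upper: "F k z \<le> a * u z + 9/4" for k z
  proof -
    have "l k z \<le> \<tau> z"
      unfolding l_m using ln_le_minus_one[OF m_pos, of k z] m_upper[of k z] by linarith
    moreover have "\<tau> z - (\<tau> z)\<^sup>2 \<le> 1/4"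
      using zero_le_power2[of "\<tau> z - 1/2"] by (simp add: power2_eq_square algebra_simps)
    ultimately show ?thesis by (simp add: F_def)
  qed

  have F_cpsh: "cpsh_in X A U (F k)" for k
  proof -
    have "cpsh_in X A U (\<lambda>z. u z - \<epsilon> * (norm (\<phi> z - \<phi> w0))\<^sup>2)"
    proof (rule psh_on_imp_cpsh_in)
      show "psh_on X A U (\<lambda>z. ereal (u z - \<epsilon> * (norm (\<phi> z - \<phi> w0))\<^sup>2))"
        using spsh by simp
      have "continuous_map (subtopology X U) euclideanreal u"
        using cont by (rule continuous_map_from_subtopology)
      moreover have "continuous_map (subtopology X U) euclideanreal (\<lambda>z. norm (\<phi> z - \<phi> w0))"
        by (intro continuous_map_norm continuous_map_diff topological_chart_continuous[OF top]) auto
      ultimately show "continuous_map (subtopology X U) euclideanreal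
          (\<lambda>z. u z - \<epsilon> * (norm (\<phi> z - \<phi> w0))\<^sup>2)"
        by (intro continuous_map_diff continuous_map_real_mult_left continuous_map_real_pow)
    qed
    \<comment> \<open>The strict plurisubharmonicity pays for the term
      \<open>- (\<tau> z)\<^sup>2\<close> in \<open>F\<close>.\<close>
    then have "cpsh_in X A U (\<lambda>z. ln (max (norm (\<phi> z - \<phi> w)) (\<rho> / (real k + 1)))
        + a * (u z - \<epsilon> * (norm (\<phi> z - \<phi> w0))\<^sup>2) + (2 - ln \<rho>))"
      using a \<open>\<rho> > 0\<close>
      by (intro cpsh_in_add cpsh_in_scale cpsh_in_ln_max_norm[OF M c] cpsh_in_const U) auto
    then show ?thesis
      by (rule cpsh_in_cong)
         (use \<open>\<epsilon> > 0\<close> \<open>\<rho> > 0\<close> in \<open>simp add: F_def l_def \<tau>_def a_def field_simps\<close>)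
  qed
  have au_cpsh: "cpsh_in X A (topspace X) (\<lambda>z. a * u z)"
    using psh cont a by (intro cpsh_in_scale psh_on_imp_cpsh_in) auto
  have g_cpsh: "cpsh_in X A (topspace X) (g k)" for k
  proof (rule cpsh_in_local)
    fix z assume z: "z \<in> topspace X"
    \<comment> \<open>Three open sets covering the manifold, on which \<open>g k\<close> is
      \<open>F k\<close>, the maximum, and \<open>a * u\<close> respectively. \<open>F_inner\<close>
      reconciles the first two descriptions for \<open>3/4 < \<tau> z < 1\<close>, and
      \<open>F_outer\<close> the last two for \<open>7/4 < \<tau> z < 2\<close>.\<close>
    define N1 where "N1 = {z\<in>U. \<phi> z \<in> ball (\<phi> w0) \<rho>}"
    define N2 where "N2 = {z\<in>U. \<phi> z \<in> ball (\<phi> w0) (2*\<rho>) - cball (\<phi> w0) (3/4*\<rho>)}"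
    define N3 where "N3 = topspace X - {z\<in>U. \<phi> z \<in> cball (\<phi> w0) (7/4*\<rho>)}"
    have N1: "openin X N1" "N1 \<subseteq> U" "\<And>z. z \<in> N1 \<longleftrightarrow> z \<in> U \<and> \<tau> z < 1"
      unfolding N1_def using topological_chart_openin_preimage[OF top, of "ball (\<phi> w0) \<rho>"] \<open>\<rho> > 0\<close>
      by (auto simp: \<tau>_def dist_norm norm_minus_commute field_simps)
    have N2: "openin X N2" "N2 \<subseteq> U" "\<And>z. z \<in> N2 \<longleftrightarrow> z \<in> U \<and> 3/4 < \<tau> z \<and> \<tau> z < 2"
      unfolding N2_def
      using topological_chart_openin_preimage[OF top, of "ball (\<phi> w0) (2*\<rho>) - cball (\<phi> w0) (3/4*\<rho>)"]
        open_Diff[OF open_ball closed_cball] \<open>\<rho> > 0\<close>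
      by (auto simp: \<tau>_def dist_norm norm_minus_commute field_simps)
    have "closedin X {z\<in>U. \<phi> z \<in> cball (\<phi> w0) (7/4*\<rho>)}"
    proof (rule closedin_chart_cball[OF _ top])
      show "Hausdorff_space X" using M by (simp add: complex_manifold_def)
      have "cball (\<phi> w0) (7/4*\<rho>) \<subseteq> cball (\<phi> w0) (2*\<rho>)" using \<open>\<rho> > 0\<close> by (intro subset_cball) simp
      with sub show "cball (\<phi> w0) (7/4*\<rho>) \<subseteq> \<phi> ` U" by blast
    qed
    then have N3: "openin X N3" "N3 \<subseteq> topspace X"
        "\<And>z. z \<in> N3 \<longleftrightarrow> z \<in> topspace X \<and> \<not> (z \<in> U \<and> \<tau> z \<le> 7/4)"
      unfolding N3_def using \<open>\<rho> > 0\<close>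
      by (auto simp: \<tau>_def dist_norm norm_minus_commute field_simps)
    have "cpsh_in X A N1 (g k)"
      by (rule cpsh_in_cong[OF cpsh_in_subset[OF F_cpsh[of k] N1(1,2)]]) (simp add: g_def N1(3))
    moreover have "cpsh_in X A N2 (g k)"
    proof (rule cpsh_in_cong)
      show "cpsh_in X A N2 (\<lambda>z. max (F k z) (a * u z))"
        using N2 U(2) by (intro cpsh_in_max cpsh_in_subset[OF F_cpsh] cpsh_in_subset[OF au_cpsh]) auto
      show "max (F k z) (a * u z) = g k z" if "z \<in> N2" for z
        using F_inner[of z k] that by (auto simp: g_def N2(3) max_def)
    qed
    moreover have "cpsh_in X A N3 (g k)"
    proof (rule cpsh_in_cong[OF cpsh_in_subset[OF au_cpsh N3(1,2)]])
      show "a * u z = g k z" if "z \<in> N3" for z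
        using F_outer[of z k] that by (auto simp: g_def N3(3) max_def)
    qed
    moreover have "z \<in> N1 \<or> z \<in> N2 \<or> z \<in> N3"
      using z unfolding N1(3) N2(3) N3(3) by linarith
    ultimately show "\<exists>N. z \<in> N \<and> cpsh_in X A N (g k)" by blast
  qed simp

  have "psh X A v"
    unfolding v_def
  proof (rule psh_on_INF)
    show "cpsh_in X A (topspace X) (\<lambda>z. g k z - C)" for k
      using cpsh_in_add[OF g_cpsh cpsh_in_const[of X "topspace X" A "- C"]] by simp
    show "g (Suc k) z - C \<le> g k z - C" for k z
      using l_decr[of k z] by (auto simp: g_def F_def)
  qed
  moreover have "v z < 0" if "z \<in> topspace X" for z
  proof -
    have "g 0 z \<le> a * u z + 9/4" using F_upper[of 0 z] by (auto simp: g_def)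
    then have "g 0 z - C < 0" using au[OF that] by (simp add: C_def abs_le_iff)
    moreover have "v z \<le> ereal (g 0 z - C)" unfolding v_def by (rule INF_lower) simp
    ultimately show ?thesis by (simp add: le_less_trans)
  qed
  moreover have "logarithmic_pole X A v w"
    unfolding logarithmic_pole_def
  \<comment> \<open>The pole is tested where \<open>\<tau> z < 1\<close>: there \<open>g k\<close>
    is \<open>F k\<close>, and \<open>C\<close> absorbs everything except the logarithm.\<close>
  proof (intro bexI[of _ "({z\<in>U. \<phi> z \<in> ball (\<phi> w0) \<rho>}, \<phi>)"], unfold split_conv, intro conjI exI ballI)
    show "({z\<in>U. \<phi> z \<in> ball (\<phi> w0) \<rho>}, \<phi>) \<in> holomorphic_charts X A"
      by (rule holomorphic_chart_restrict[OF c open_ball])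
    show "w \<in> {z\<in>U. \<phi> z \<in> ball (\<phi> w0) \<rho>}"
      using w \<open>\<rho> > 0\<close> by (simp add: dist_norm norm_minus_commute)
    fix z assume z: "z \<in> {z\<in>U. \<phi> z \<in> ball (\<phi> w0) \<rho>}"
    then have "\<tau> z < 1" "z \<in> topspace X"
      using U(2) \<open>\<rho> > 0\<close> by (auto simp: \<tau>_def dist_norm norm_minus_commute)
    then have "\<bar>a * u z\<bar> \<le> a * B" "g k z = F k z" for k
      using z by (auto intro: au simp: g_def)
    then have "g k z - C \<le> l k z" for k
      unfolding F_def C_def using zero_le_power2[of "\<tau> z"] by (smt (verit))
    then show "v z \<le> elog (norm (\<phi> z - \<phi> w)) + ereal (- ln \<rho>)"
      unfolding v_def using \<open>\<rho> > 0\<close> by (intro INF_le_elog) (auto simp: l_def)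
  qed
  ultimately have "v z0 \<le> green_function X A z0 w"
    unfolding green_function_def by (intro SUP_upper) simp
  moreover have "elog (norm (\<phi> z0 - \<phi> w)) + ereal (- ln \<rho> - 2 * B / (\<epsilon> * \<rho>\<^sup>2) - 2) \<le> v z0"
    unfolding v_def
  proof (rule INF_greatest)
    fix k
    have t: "0 \<le> \<tau> z0" "\<tau> z0 < 1" using z0 \<open>\<rho> > 0\<close> by (auto simp: \<tau>_def)
    then have "(\<tau> z0)\<^sup>2 \<le> 1" by (simp add: power_le_one)
    moreover have "\<bar>a * u z0\<bar> \<le> a * B" using au z0(1) U(2) by blast
    moreover have "g k z0 = F k z0" using t z0(1) by (simp add: g_def)
    \<comment> \<open>The worst case is \<open>-1\<close> from the square, \<open>- a * B\<close>
      from \<open>u\<close>, and \<open>2 - C\<close>.\<close>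
    ultimately have "g k z0 - C \<ge> l k z0 - 2 * (a * B) - 2"
      unfolding F_def C_def by linarith
    then have *: "ln (max (norm (\<phi> z0 - \<phi> w)) (\<rho> / (real k + 1))) +
        (- ln \<rho> - 2 * B / (\<epsilon> * \<rho>\<^sup>2) - 2) \<le> g k z0 - C"
      by (simp add: l_def a_def)
    have "elog (norm (\<phi> z0 - \<phi> w)) \<le> ereal (ln (max (norm (\<phi> z0 - \<phi> w)) (\<rho> / (real k + 1))))"
      by (auto simp: elog_def intro!: ln_mono)
    then have "elog (norm (\<phi> z0 - \<phi> w)) + ereal (- ln \<rho> - 2 * B / (\<epsilon> * \<rho>\<^sup>2) - 2)
      \<le> ereal (ln (max (norm (\<phi> z0 - \<phi> w)) (\<rho> / (real k + 1)))) + ereal (- ln \<rho> - 2 * B / (\<epsilon> * \<rho>\<^sup>2) - 2)"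
      by (rule add_right_mono)
    also have "\<dots> \<le> ereal (g k z0 - C)" using * by simp
    finally show "elog (norm (\<phi> z0 - \<phi> w)) + ereal (- ln \<rho> - 2 * B / (\<epsilon> * \<rho>\<^sup>2) - 2) \<le> ereal (g k z0 - C)" .
  qed
  ultimately show ?thesis by (rule order.trans[rotated])
qed

theorem theorem3p8:
  fixes X :: "'a topology" and A :: "('a, 'n::finite) chart set" and u :: "'a \<Rightarrow> real"
  assumes "complex_manifold X A"
    and "connected_space X"
    and "continuous_map X euclideanreal u"
    and "bounded (u ` topspace X)"
    and "strictly_psh X A (\<lambda>z. ereal (u z))"
  shows "locally_uniformly_pluri_greenian X A"
  unfolding locally_uniformly_pluri_greenian_def
proof
  fix w0 assume w0: "w0 \<in> topspace X"
  obtain B where B: "\<And>z. z \<in> topspace X \<Longrightarrow> \<bar>u z\<bar> \<le> B"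
    using assms(4) by (auto simp: bounded_iff)
  obtain U \<phi> \<epsilon> where c: "(U, \<phi>) \<in> holomorphic_charts X A" "w0 \<in> U" and "\<epsilon> > 0"
    and spsh: "psh_on X A U (\<lambda>z. ereal (u z) - ereal (\<epsilon> * (norm (\<phi> z - \<phi> w0))\<^sup>2))"
    using assms(5) w0 unfolding strictly_psh_def by blast
  have psh: "psh X A (\<lambda>z. ereal (u z))" using assms(5) by (simp add: strictly_psh_def)
  have top: "topological_chart X (U, \<phi>)" using c(1) by (simp add: holomorphic_charts_def)
  obtain r where r: "r > 0" "cball (\<phi> w0) r \<subseteq> \<phi> ` U"
    using topological_chartD(4)[OF top] c(2) by (meson imageI open_contains_cball)
  \<comment> \<open>Halved because the gluing extends to radius \<open>2 * \<rho>\<close>.\<close>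
  define \<rho> where "\<rho> = r / 2"
  have \<rho>: "\<rho> > 0" "cball (\<phi> w0) (2 * \<rho>) \<subseteq> \<phi> ` U" using r by (simp_all add: \<rho>_def)
  define W where "W = {z\<in>U. \<phi> z \<in> ball (\<phi> w0) (\<rho> / 16)}"
  have W: "z \<in> U" "norm (\<phi> z - \<phi> w0) < \<rho> / 16" "norm (\<phi> z - \<phi> w0) < \<rho>" if "z \<in> W" for z
    using that \<rho>(1) by (auto simp: W_def dist_norm norm_minus_commute)
  show "\<exists>(U, \<phi>)\<in>holomorphic_charts X A. w0 \<in> U \<and>
      (\<exists>W (c::real). openin X W \<and> W \<subseteq> U \<and> w0 \<in> W \<and>
        (\<forall>w\<in>W. \<forall>z\<in>U. elog (norm (\<phi> z - \<phi> w)) + ereal c \<le> green_function X A z w))"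
  \<comment> \<open>The same set \<open>W\<close> serves as the coordinate neighborhood and as the
    set of admissible poles.\<close>
  proof (intro bexI[of _ "(W, \<phi>)"], unfold split_conv, intro conjI exI ballI)
    show "(W, \<phi>) \<in> holomorphic_charts X A"
      unfolding W_def by (rule holomorphic_chart_restrict[OF c(1) open_ball])
    show "w0 \<in> W" "w0 \<in> W" using c(2) \<rho>(1) by (auto simp: W_def)
    show "openin X W"
      unfolding W_def by (rule topological_chart_openin_preimage[OF top open_ball])
    fix w z assume "w \<in> W" "z \<in> W"
    then show "elog (norm (\<phi> z - \<phi> w)) + ereal (- ln \<rho> - 2 * B / (\<epsilon> * \<rho>\<^sup>2) - 2)
        \<le> green_function X A z w"
      using W by (intro green_function_lower_bound[OF assms(1,3) B psh c(1) \<open>\<epsilon> > 0\<close> spsh \<rho>]) auto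
  qed simp
qed

end
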